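(* The map $\Psi:\mathcal E\to\mathcal E$, $\Psi(\theta)=\big(\mathbb E[X^*_t(\theta)]\big)_{t\in[0,T]}$, is well defined (i.e. $\Psi(\theta)\in\mathcal E$ for any $\theta\in\mathcal E$) and admits a fixed point.
   Context: $T>0$, $\sigma>0$, $\rho>0$, $K>0$, $\alpha\in\mathbb R$ are constants and $x\in\mathbb R$ is the fixed initial state; $(\Omega,\mathcal F,\mathbb F,\mathbb P)$ is a complete filtered probability space satisfying the usual conditions with a one-dimensional $\mathbb F$-Brownian motion $W$. $\Theta$ is the set of bounded, non-increasing, càdlàg functions $\theta:[0,T]\to\mathbb R$. For $\theta\in\Theta$ and $(t,y)\in[0,T]\times\mathbb R$ let $\mathcal T_t$ be the set of $\mathbb F$-stopping times with values in $[0,T-t]$, $X^y_s=y+\sigma W_s$, and $$v(t,y;\theta)=\inf_{\tau\in\mathcal T_t}\mathbb E\Big[\int_0^\tau e^{-\rho s}\big(X^y_s-\alpha(2-\alpha)\theta_{s+t}\big)ds+Ke^{-\rho\tau}\Big].$$ The free boundary associated with $\theta$ is $b_t(\theta)=\inf\{y\in\mathbb R:\ v(t,y;\theta)\ge K\}$, $t\in[0,T]$, with $\inf\emptyset=+\infty$. The control $\xi^*_t(\theta)=\sup_{s\in[0,t]}(x+\sigma W_s-b_s(\theta))^+$, $t\in[0,T]$, is the optimal control for the problem of minimizing $\mathbb E\big[\int_0^Te^{-\rho t}(\frac12(X^\xi_t-\alpha\theta_t)^2-\alpha(1-\alpha)\theta_tX^\xi_t)dt+K\int_{[0,T]}e^{-\rho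 t}d\xi_t\big]$, with $X^\xi_t=x+\sigma W_t-\xi_t$, over $\mathbb F$-adapted non-decreasing càdlàg processes $\xi$ with $\xi_{0-}=0$ and $\mathbb E[\xi_T^2]<\infty$; $X^*_t(\theta)=x+\sigma W_t-\xi^*_t(\theta)$ is the corresponding state. $\delta$ is a sufficiently large positive constant depending on $\sigma,T,x,\alpha,K,\rho$; for $\delta$ sufficiently large one has $\mathbb E[\xi^*_T(\theta)]\le\delta$ both when $\theta\equiv x-\delta$ and when $\theta\equiv x$. The set $\mathcal E$ is $$\mathcal E=\{\theta\in\Theta:\ x-\delta\le\theta_t\le x\ \text{ for } t\in[0,T]\}.$$
   Formalization: Literally b_T(θ) = −∞, so ξ*_T = +∞; the supremum defining ξ*_t is therefore taken over s in [0,t] with s ≠ T (b_T read as its left limit). "δ sufficiently large" means δ>0 with E[ξ*_T] ≤ δ for θ≡x−δ and θ≡x (no such δ exists for α=1 and small K). *)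

theory Defs
  imports "HOL-Probability.Probability"
begin

(* The horizon is finite, so the usual conditions and the Brownian motion are only required on
   [0,T].  The library's filtrations are indexed by the whole real line; the members with index
   outside [0,T] play no role, since a time with values in [0,T] satisfies the stopping time
   condition trivially there. *)

definition usual_conditions :: "'a measure \<Rightarrow> (real \<Rightarrow> 'a measure) \<Rightarrow> real \<Rightarrow> bool" where
  "usual_conditions M F T \<longleftrightarrow>
     prob_space M \<and> complete_measure M \<and>
     filtration (space M) F \<and> (\<forall>t. subalgebra M (F t)) \<and>
     null_sets M \<subseteq> sets (F 0) \<and>
     (\<forall>t\<in>{0..<T}. sets (F t) = (\<Inter>s\<in>{t<..T}. sets (F s)))"

definition brownian_motion ::
  "'a measure \<Rightarrow> (real \<Rightarrow> 'a measure) \<Rightarrow> real \<Rightarrow> (real \<Rightarrow> 'a \<Rightarrow> real) \<Rightarrow> bool" where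
  "brownian_motion M F T W \<longleftrightarrow>
     (\<forall>t\<in>{0..T}. W t \<in> borel_measurable (F t)) \<and>
     (AE \<omega> in M. W 0 \<omega> = 0) \<and>
     (AE \<omega> in M. continuous_on {0..T} (\<lambda>t. W t \<omega>)) \<and>
     (\<forall>s t. 0 \<le> s \<and> s < t \<and> t \<le> T \<longrightarrow>
        distributed M lborel (\<lambda>\<omega>. W t \<omega> - W s \<omega>) (normal_density 0 (sqrt (t - s))) \<and>
        prob_space.indep_set M (sets (F s))
          {(\<lambda>\<omega>. W t \<omega> - W s \<omega>) -` B \<inter> space M | B. B \<in> sets borel})"

definition cadlag_on :: "real \<Rightarrow> (real \<Rightarrow> real) \<Rightarrow> bool" where
  "cadlag_on T \<theta> \<longleftrightarrow>
     (\<forall>t\<in>{0..<T}. (\<theta> \<longlongrightarrow> \<theta> t) (at_right t)) \<and>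
     (\<forall>t\<in>{0<..T}. \<exists>l. (\<theta> \<longlongrightarrow> l) (at_left t))"

(* Functions on [0,T] are elements of extensional {0..T}, so that equality of two of them means
   equality on [0,T]. *)

definition Theta :: "real \<Rightarrow> (real \<Rightarrow> real) set" where
  "Theta T = {\<theta> \<in> extensional {0..T}.
     bounded (\<theta> ` {0..T}) \<and> antimono_on {0..T} \<theta> \<and> cadlag_on T \<theta>}"

definition stopping_times ::
  "'a measure \<Rightarrow> (real \<Rightarrow> 'a measure) \<Rightarrow> real \<Rightarrow> real \<Rightarrow> ('a \<Rightarrow> real) set" where
  "stopping_times M F T t =
     {\<tau>. stopping_time F \<tau> \<and> (\<forall>\<omega>\<in>space M. 0 \<le> \<tau> \<omega> \<and> \<tau> \<omega> \<le> T - t)}"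

(* The infimum is over a set of reals that is nonempty (it contains the payoff K of \<tau> = 0) and,
   the horizon being finite and \<theta> bounded, bounded below. *)

definition value_fun ::
  "'a measure \<Rightarrow> (real \<Rightarrow> 'a measure) \<Rightarrow> (real \<Rightarrow> 'a \<Rightarrow> real) \<Rightarrow>
   real \<Rightarrow> real \<Rightarrow> real \<Rightarrow> real \<Rightarrow> real \<Rightarrow> (real \<Rightarrow> real) \<Rightarrow> real \<Rightarrow> real \<Rightarrow> real" where
  "value_fun M F W T \<sigma> \<rho> K \<alpha> \<theta> t y =
     (INF \<tau>\<in>stopping_times M F T t.
        prob_space.expectation M (\<lambda>\<omega>.
          (LBINT s:{0..\<tau> \<omega>}.
             exp (- \<rho> * s) * ((y + \<sigma> * W s \<omega>) - \<alpha> * (2 - \<alpha>) * \<theta> (s + t)))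
          + K * exp (- \<rho> * \<tau> \<omega>)))"

definition free_boundary ::
  "'a measure \<Rightarrow> (real \<Rightarrow> 'a measure) \<Rightarrow> (real \<Rightarrow> 'a \<Rightarrow> real) \<Rightarrow>
   real \<Rightarrow> real \<Rightarrow> real \<Rightarrow> real \<Rightarrow> real \<Rightarrow> (real \<Rightarrow> real) \<Rightarrow> real \<Rightarrow> ereal" where
  "free_boundary M F W T \<sigma> \<rho> K \<alpha> \<theta> t =
     Inf (ereal ` {y. K \<le> value_fun M F W T \<sigma> \<rho> K \<alpha> \<theta> t y})"

(* At the terminal time the only stopping time is 0, so value_fun is identically K and the
   boundary degenerates to -\<infinity>.  The boundary that drives the control at T is its left limit;
   by continuity of W this amounts to leaving s = T out of the supremum, as is done here.  For
   t < T the supremum is over all of [0,t]. *)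

definition opt_control ::
  "'a measure \<Rightarrow> (real \<Rightarrow> 'a measure) \<Rightarrow> (real \<Rightarrow> 'a \<Rightarrow> real) \<Rightarrow>
   real \<Rightarrow> real \<Rightarrow> real \<Rightarrow> real \<Rightarrow> real \<Rightarrow> real \<Rightarrow> (real \<Rightarrow> real) \<Rightarrow> real \<Rightarrow> 'a \<Rightarrow> ereal" where
  "opt_control M F W T \<sigma> \<rho> K \<alpha> x \<theta> t \<omega> =
     (SUP s\<in>{0..t} - {T}.
        max 0 (ereal (x + \<sigma> * W s \<omega>) - free_boundary M F W T \<sigma> \<rho> K \<alpha> \<theta> s))"

(* real_of_ereal maps \<infinity> to 0, so this is the state only where the control is finite. *)

definition opt_state ::
  "'a measure \<Rightarrow> (real \<Rightarrow> 'a measure) \<Rightarrow> (real \<Rightarrow> 'a \<Rightarrow> real) \<Rightarrow>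
   real \<Rightarrow> real \<Rightarrow> real \<Rightarrow> real \<Rightarrow> real \<Rightarrow> real \<Rightarrow> (real \<Rightarrow> real) \<Rightarrow> real \<Rightarrow> 'a \<Rightarrow> real" where
  "opt_state M F W T \<sigma> \<rho> K \<alpha> x \<theta> t \<omega> =
     x + \<sigma> * W t \<omega> - real_of_ereal (opt_control M F W T \<sigma> \<rho> K \<alpha> x \<theta> t \<omega>)"

definition Psi ::
  "'a measure \<Rightarrow> (real \<Rightarrow> 'a measure) \<Rightarrow> (real \<Rightarrow> 'a \<Rightarrow> real) \<Rightarrow>
   real \<Rightarrow> real \<Rightarrow> real \<Rightarrow> real \<Rightarrow> real \<Rightarrow> real \<Rightarrow> (real \<Rightarrow> real) \<Rightarrow> real \<Rightarrow> real" where
  "Psi M F W T \<sigma> \<rho> K \<alpha> x \<theta> =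
     (\<lambda>t\<in>{0..T}. prob_space.expectation M (opt_state M F W T \<sigma> \<rho> K \<alpha> x \<theta> t))"

definition E_set :: "real \<Rightarrow> real \<Rightarrow> real \<Rightarrow> (real \<Rightarrow> real) set" where
  "E_set T x \<delta> = {\<theta> \<in> Theta T. \<forall>t\<in>{0..T}. x - \<delta> \<le> \<theta> t \<and> \<theta> t \<le> x}"

(* The expectation is the integral of a nonnegative extended real, hence also meaningful when
   the control is not integrable. *)

definition control_mean ::
  "'a measure \<Rightarrow> (real \<Rightarrow> 'a measure) \<Rightarrow> (real \<Rightarrow> 'a \<Rightarrow> real) \<Rightarrow>
   real \<Rightarrow> real \<Rightarrow> real \<Rightarrow> real \<Rightarrow> real \<Rightarrow> real \<Rightarrow> (real \<Rightarrow> real) \<Rightarrow> ennreal" where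
  "control_mean M F W T \<sigma> \<rho> K \<alpha> x \<theta> =
     (\<integral>\<^sup>+ \<omega>. e2ennreal (opt_control M F W T \<sigma> \<rho> K \<alpha> x \<theta> T \<omega>) \<partial>M)"

(* What "sufficiently large" means for \<delta>.  It is kept as a condition on \<delta> because not every
   choice of the remaining parameters admits such a \<delta> (for \<alpha> = 1 and small K none exists). *)

definition sufficiently_large ::
  "'a measure \<Rightarrow> (real \<Rightarrow> 'a measure) \<Rightarrow> (real \<Rightarrow> 'a \<Rightarrow> real) \<Rightarrow>
   real \<Rightarrow> real \<Rightarrow> real \<Rightarrow> real \<Rightarrow> real \<Rightarrow> real \<Rightarrow> real \<Rightarrow> bool" where
  "sufficiently_large M F W T \<sigma> \<rho> K \<alpha> x \<delta> \<longleftrightarrow>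
     0 < \<delta> \<and>
     control_mean M F W T \<sigma> \<rho> K \<alpha> x (\<lambda>t\<in>{0..T}. x - \<delta>) \<le> ennreal \<delta> \<and>
     control_mean M F W T \<sigma> \<rho> K \<alpha> x (\<lambda>t\<in>{0..T}. x) \<le> ennreal \<delta>"

end

(* The stopping problem is a comparison of running costs, so the boundary depends on theta in a
   monotone way and is Lipschitz in the supremum norm with constant |alpha (2 - alpha)|,
   uniformly in time; the same holds for the control and hence for Psi, and monotonicity
   together with the hypothesis on delta gives that Psi maps E into itself. On step functions
   over a grid Psi is therefore a continuous self-map of a cube, and Kuhn's combinatorial lemma
   (the finite form of Brouwer's theorem) yields approximate fixed points. By Helly's theorem a
   subsequence of them converges at the continuity points of a limit g. The supremum norm is too
   strong here, but at a continuity point t of g the boundary converges: it is lower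
   semicontinuous because a stopping time that does better than K keeps doing so after a small
   perturbation, and upper semicontinuous by the local comparison in value_ge_eventually. Both
   are enough to pass to the limit in the suprema defining the control. *)

theory Submission
  imports Defs
begin

text \<open>With \<open>c\<close> = \<alpha>(2 - \<alpha>) = 1 - (1 - \<alpha>)^2, Psi preserves the
  order of profiles for \<open>c\<close> >= 0 and reverses it for \<open>c\<close> < 0, and its
  Lipschitz constant |c| need not be below 1. Neither a lattice argument nor a contraction therefore
  covers every \<alpha>, which is why a topological argument is used. Two obstacles shape the
  passage to the limit. The boundary degenerates at T, so convergence of the control is proved for t
  < T only, where suprema run over a compact interval away from T. The fixed point equation is then
  obtained on [0,T), and the image of the limit, not the limit itself, solves it on all of [0,T].
  Moreover, a step function matches its image only at grid nodes. The resulting time lag turns the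
  limit equation into two inequalities between values at neighbouring times, which monotonicity and
  right-continuity close up.\<close>

section \<open>Measurability on a complete space and of continuous processes\<close>

lemma (in complete_measure) borel_measurable_AE_eq:
  fixes f g :: "'a \<Rightarrow> 'b::topological_space"
  assumes g: "g \<in> borel_measurable M" and eq: "AE x in M. f x = g x"
  shows "f \<in> borel_measurable M"
proof (rule borel_measurableI)
  fix S :: "'b set" assume "open S"
  then have "g -` S \<inter> space M \<in> sets M"
    using g by (simp add: measurable_sets)
  then show "f -` S \<inter> space M \<in> sets M"
    by (rule in_sets_AE[rotated]) (use eq in \<open>auto elim!: eventually_mono\<close>)
qed

text \<open>Sampling s at the grid point just below it leaves a function with countably many
  sections in s, each measurable. Continuity in s makes these samplings converge pointwise as the
  mesh shrinks.\<close>

lemma borel_measurable_pair_continuous: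
  fixes f :: "'a \<Rightarrow> real \<Rightarrow> real"
  assumes meas: "\<And>s. (\<lambda>\<omega>. f \<omega> s) \<in> borel_measurable M"
    and cont: "\<And>\<omega>. \<omega> \<in> space M \<Longrightarrow> continuous_on UNIV (f \<omega>)"
  shows "(\<lambda>(\<omega>, s). f \<omega> s) \<in> borel_measurable (M \<Otimes>\<^sub>M lborel)"
proof -
  let ?g = "\<lambda>n (\<omega>, s). f \<omega> (real_of_int \<lfloor>real (Suc n) * s\<rfloor> / real (Suc n))"
  show ?thesis
  proof (rule borel_measurable_LIMSEQ_real[where u = ?g])
    show "?g n \<in> borel_measurable (M \<Otimes>\<^sub>M lborel)" for n
    proof -
      have "(\<lambda>p. (\<lambda>i p. f (fst p) (real_of_int i / real (Suc n))) \<lfloor>real (Suc n) * snd p\<rfloor> p)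
          \<in> borel_measurable (M \<Otimes>\<^sub>M lborel)"
      proof (rule measurable_compose_countable[where f = "\<lambda>i p. f (fst p) (real_of_int i / real (Suc n))"
            and g = "\<lambda>p. \<lfloor>real (Suc n) * snd p\<rfloor>"])
        show "(\<lambda>p. f (fst p) (real_of_int i / real (Suc n))) \<in> borel_measurable (M \<Otimes>\<^sub>M lborel)" for i
          by (rule measurable_compose[OF measurable_fst meas])
        show "(\<lambda>p. \<lfloor>real (Suc n) * snd p\<rfloor>) \<in> (M \<Otimes>\<^sub>M lborel) \<rightarrow>\<^sub>M count_space UNIV"
          by measurable
      qed
      then show ?thesis by (simp add: split_beta')
    qed
    fix p :: "'a \<times> real" assume "p \<in> space (M \<Otimes>\<^sub>M lborel)"
    then obtain \<omega> s where p: "p = (\<omega>, s)" and \<omega>: "\<omega> \<in> space M"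
      by (auto simp: space_pair_measure)
    have "(\<lambda>n. real_of_int \<lfloor>real (Suc n) * s\<rfloor> / real (Suc n)) \<longlonglongrightarrow> s"
    proof (rule tendsto_sandwich)
      show "(\<lambda>n. s - 1 / real (Suc n)) \<longlonglongrightarrow> s"
        using tendsto_diff[OF tendsto_const[of s] lim_1_over_n[THEN LIMSEQ_Suc]] by simp
      show "\<forall>\<^sub>F n in sequentially. s - 1 / real (Suc n) \<le> real_of_int \<lfloor>real (Suc n) * s\<rfloor> / real (Suc n)"
      proof (intro always_eventually allI)
        fix n
        have "real (Suc n) * s - 1 \<le> real_of_int \<lfloor>real (Suc n) * s\<rfloor>" by linarith
        then have "(real (Suc n) * s - 1) / real (Suc n) \<le> real_of_int \<lfloor>real (Suc n) * s\<rfloor> / real (Suc n)"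
          by (rule divide_right_mono) simp
        then show "s - 1 / real (Suc n) \<le> real_of_int \<lfloor>real (Suc n) * s\<rfloor> / real (Suc n)"
          by (simp add: diff_divide_distrib del: of_nat_Suc)
      qed
      show "\<forall>\<^sub>F n in sequentially. real_of_int \<lfloor>real (Suc n) * s\<rfloor> / real (Suc n) \<le> s"
      proof (intro always_eventually allI)
        fix n
        have "real_of_int \<lfloor>real (Suc n) * s\<rfloor> \<le> real (Suc n) * s" by linarith
        then show "real_of_int \<lfloor>real (Suc n) * s\<rfloor> / real (Suc n) \<le> s"
          by (simp add: divide_le_eq mult.commute del: of_nat_Suc)
      qed
    qed auto
    moreover have "isCont (f \<omega>) s"
      using cont[OF \<omega>] by (simp add: continuous_on_eq_continuous_at)
    ultimately show "(\<lambda>n. ?g n p) \<longlonglongrightarrow> (\<lambda>(\<omega>, s). f \<omega> s) p"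
      using isCont_tendsto_compose[of s "f \<omega>"] by (simp add: p)
  qed
qed

section \<open>Approximate fixed points in a cube\<close>

lemma approximate_fixed_point_cube:
  fixes H :: "(nat \<Rightarrow> real) \<Rightarrow> nat \<Rightarrow> real"
  assumes range: "\<And>a i. (\<And>j. j < n \<Longrightarrow> 0 \<le> a j \<and> a j \<le> 1) \<Longrightarrow> i < n \<Longrightarrow> 0 \<le> H a i \<and> H a i \<le> 1"
    and lip: "\<And>a a' i e. (\<And>j. j < n \<Longrightarrow> 0 \<le> a j \<and> a j \<le> 1) \<Longrightarrow> (\<And>j. j < n \<Longrightarrow> 0 \<le> a' j \<and> a' j \<le> 1) \<Longrightarrow>
      (\<And>j. j < n \<Longrightarrow> \<bar>a j - a' j\<bar> \<le> e) \<Longrightarrow> i < n \<Longrightarrow> \<bar>H a i - H a' i\<bar> \<le> L * e"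
    and "0 \<le> L" "0 < e"
  obtains a where "\<And>j. j < n \<Longrightarrow> 0 \<le> a j \<and> a j \<le> 1" "\<And>i. i < n \<Longrightarrow> \<bar>H a i - a i\<bar> \<le> e"
proof -
  \<comment> \<open>With mesh 1/p the vertices of one small cube differ by at most 1/p in each
    coordinate and their images by at most L/p; the two errors must add up to at most e.\<close>
  obtain p :: nat where p: "(L + 1) / e < real p"
    using reals_Archimedean2 by blast
  have "0 < (L + 1) / e" using assms by simp
  with p have p0: "0 < p" by (metis less_trans of_nat_0_less_iff)
  have pe: "L / real p + 1 / real p \<le> e"
    using p p0 \<open>0 < e\<close> by (simp add: field_simps)
  define pt where "pt q = (\<lambda>j. real (q j) / real p)" for q :: "nat \<Rightarrow> nat"
  \<comment> \<open>Label 0 means that \<open>H\<close> does not push coordinate i down. The faces q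
    i = 0 and q i = p get the labels 0 and 1 that Kuhn's lemma asks for, which agree with the sign
    of \<open>H\<close> - id because \<open>H\<close> stays in [0,1].\<close>
  define label where "label q i = (if q i \<noteq> p \<and> (q i = 0 \<or> pt q i \<le> H (pt q) i) then 0 else 1::nat)" for q i
  have cube: "\<And>j. j < n \<Longrightarrow> 0 \<le> pt q j \<and> pt q j \<le> 1" if "\<forall>j<n. q j \<le> p" for q
    using that p0 by (auto simp: pt_def)
  obtain q where q: "\<forall>i<n. q i < p"
    and rs: "\<forall>i<n. \<exists>r s. (\<forall>j<n. q j \<le> r j \<and> r j \<le> q j + 1) \<and> (\<forall>j<n. q j \<le> s j \<and> s j \<le> q j + 1) \<and> label r i \<noteq> label s i"
    by (rule kuhn_lemma[of p n label, OF p0]) (use p0 in \<open>auto simp: label_def\<close>)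
  have close: "\<bar>H (pt q) i - H (pt r) i\<bar> \<le> L / real p \<and> pt q i \<le> pt r i \<and> pt r i \<le> pt q i + 1 / real p
     \<and> (\<forall>j<n. r j \<le> p) "
    if "i < n" and r: "\<forall>j<n. q j \<le> r j \<and> r j \<le> q j + 1" for r i
  proof -
    have rp: "\<forall>j<n. r j \<le> p" using q r by fastforce
    have d: "pt q j \<le> pt r j \<and> pt r j \<le> pt q j + 1 / real p" if "j < n" for j
    proof -
      have "real (q j) \<le> real (r j) \<and> real (r j) \<le> real (q j) + 1"
        using r that by (metis of_nat_le_iff of_nat_1 of_nat_add)
      then show ?thesis using p0 by (simp add: pt_def field_simps)
    qed
    have "\<bar>H (pt q) i - H (pt r) i\<bar> \<le> L * (1 / real p)"
    proof (rule lip)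
      show "\<bar>pt q j - pt r j\<bar> \<le> 1 / real p" if "j < n" for j using d[OF that] by linarith
    qed (use cube q rp that in \<open>auto simp: less_imp_le\<close>)
    then show ?thesis using d[OF \<open>i < n\<close>] rp by simp
  qed
  have Hr: "0 \<le> H (pt r) i \<and> H (pt r) i \<le> 1" if "\<forall>j<n. r j \<le> p" "i < n" for r i
    by (rule range[OF cube[OF that(1)] that(2)])
  have lab0: "pt r i \<le> H (pt r) i" if "label r i = 0" "i < n" "\<forall>j<n. r j \<le> p" for r i
    using that Hr[OF that(3,2)] by (auto simp: label_def pt_def split: if_splits)
  have lab1: "H (pt r) i \<le> pt r i" if "label r i \<noteq> 0" "i < n" "\<forall>j<n. r j \<le> p" for r i
    using that Hr[OF that(3,2)] p0 by (auto simp: label_def pt_def split: if_splits)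
  show ?thesis
  proof
    show "\<And>j. j < n \<Longrightarrow> 0 \<le> pt q j \<and> pt q j \<le> 1" using cube q by (auto simp: less_imp_le)
    fix i assume i: "i < n"
    obtain r s where r: "\<forall>j<n. q j \<le> r j \<and> r j \<le> q j + 1" and s: "\<forall>j<n. q j \<le> s j \<and> s j \<le> q j + 1"
      and ne: "label r i \<noteq> label s i" using rs i by blast
    \<comment> \<open>Opposite labels on two vertices of one small cube: \<open>H\<close> - id
      changes sign there, so it is small at the corner \<open>q\<close>.\<close>
    have "(label r i = 0 \<and> label s i \<noteq> 0) \<or> (label s i = 0 \<and> label r i \<noteq> 0)"
      using ne by (auto simp: label_def split: if_splits)
    then show "\<bar>H (pt q) i - pt q i\<bar> \<le> e"
    proof
      assume "label r i = 0 \<and> label s i \<noteq> 0"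
      then show ?thesis
        using close[OF i r] close[OF i s] lab0[of r i] lab1[of s i] i pe unfolding abs_le_iff by force
    next
      assume "label s i = 0 \<and> label r i \<noteq> 0"
      then show ?thesis
        using close[OF i r] close[OF i s] lab0[of s i] lab1[of r i] i pe unfolding abs_le_iff by force
    qed
  qed
qed

section \<open>Monotone functions and convergence at continuity points\<close>

lemma antimono_countable_discont:
  fixes g :: "real \<Rightarrow> real"
  assumes "antimono g"
  shows "countable {s. \<not> isCont g s}"
proof -
  have "mono (\<lambda>s. - g s)" using assms by (auto simp: mono_def antimono_def)
  from mono_ctble_discont[OF this] show ?thesis
    by (rule countable_subset[rotated]) (auto dest: isCont_minus)
qed

lemma antimono_isCont_between:
  fixes g :: "real \<Rightarrow> real"
  assumes "antimono g" "r < s"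
  obtains u where "r < u" "u < s" "isCont g u"
proof -
  have "uncountable ({r<..<s} - {s. \<not> isCont g s})"
    using antimono_countable_discont[OF assms(1)] assms(2)
    by (simp add: uncountable_minus_countable uncountable_open_interval)
  then have "{r<..<s} - {s. \<not> isCont g s} \<noteq> {}" by (metis countable_empty)
  then show ?thesis using that by auto
qed

lemma antimono_borel_measurable:
  fixes g :: "real \<Rightarrow> real"
  assumes "antimono g"
  shows "g \<in> borel_measurable borel"
proof -
  have "mono (\<lambda>s. - g s)" using assms by (auto simp: mono_def antimono_def)
  then have "(\<lambda>s. - (- g s)) \<in> borel_measurable borel"
    by (intro borel_measurable_uminus borel_measurable_mono)
  then show ?thesis by simp
qed

text \<open>The mode of convergence that Helly's theorem delivers, as for distribution
  functions.\<close>

definition weak_lim :: "(nat \<Rightarrow> real \<Rightarrow> real) \<Rightarrow> (real \<Rightarrow> real) \<Rightarrow> bool" where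
  "weak_lim gs g \<longleftrightarrow> (\<forall>s. isCont g s \<longrightarrow> (\<lambda>n. gs n s) \<longlonglongrightarrow> g s)"

lemma weak_lim_const: "weak_lim (\<lambda>_. g) g"
  by (simp add: weak_lim_def)

lemma weak_lim_subseq: "weak_lim gs g \<Longrightarrow> strict_mono r \<Longrightarrow> weak_lim (\<lambda>n. gs (r n)) g"
  unfolding weak_lim_def using LIMSEQ_subseq_LIMSEQ by (fastforce simp: comp_def)

text \<open>Monotonicity allows the argument to move with n: \<open>sn n\<close> eventually lies
  between two continuity points close to s on either side, where the values converge.\<close>

lemma weak_lim_shift:
  assumes anti: "antimono g" "\<And>n. antimono (gs n)" and lim: "weak_lim gs g"
    and s: "isCont g s" "sn \<longlonglongrightarrow> s"
  shows "(\<lambda>n. gs n (sn n)) \<longlonglongrightarrow> g s"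
proof (rule order_tendstoI)
  fix a assume "a < g s"
  have "eventually (\<lambda>u. a < g u) (at s)"
    using s(1) \<open>a < g s\<close> by (auto simp: isCont_def dest: order_tendstoD)
  then obtain d where d: "0 < d" "\<And>u. u \<noteq> s \<Longrightarrow> dist u s < d \<Longrightarrow> a < g u"
    by (auto simp: eventually_at)
  obtain u where u: "s < u" "u < s + d" "isCont g u" using antimono_isCont_between[OF anti(1), of s "s+d"] d by auto
  have "a < g u" using d(2)[of u] u by (auto simp: dist_real_def)
  then have "eventually (\<lambda>n. a < gs n u) sequentially"
    using lim u(3) by (auto simp: weak_lim_def dest: order_tendstoD)
  moreover have "eventually (\<lambda>n. sn n < u) sequentially" using s(2) u(1) by (rule order_tendstoD)
  ultimately show "eventually (\<lambda>n. a < gs n (sn n)) sequentially"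
    by eventually_elim (meson antimonoD[OF anti(2)] less_imp_le less_le_trans)
next
  fix a assume "g s < a"
  have "eventually (\<lambda>u. g u < a) (at s)"
    using s(1) \<open>g s < a\<close> by (auto simp: isCont_def dest: order_tendstoD)
  then obtain d where d: "0 < d" "\<And>u. u \<noteq> s \<Longrightarrow> dist u s < d \<Longrightarrow> g u < a"
    by (auto simp: eventually_at)
  obtain u where u: "s - d < u" "u < s" "isCont g u" using antimono_isCont_between[OF anti(1), of "s - d" s] d by auto
  have "g u < a" using d(2)[of u] u by (auto simp: dist_real_def)
  then have "eventually (\<lambda>n. gs n u < a) sequentially"
    using lim u(3) by (auto simp: weak_lim_def dest: order_tendstoD)
  moreover have "eventually (\<lambda>n. u < sn n) sequentially" using s(2) u(2) by (rule order_tendstoD)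
  ultimately show "eventually (\<lambda>n. gs n (sn n) < a) sequentially"
    by eventually_elim (meson antimonoD[OF anti(2)] less_imp_le le_less_trans)
qed

lemma AE_isCont_shift:
  fixes g :: "real \<Rightarrow> real"
  assumes "antimono g"
  shows "AE s in lborel. isCont g (s + t)"
proof (rule AE_I')
  have "countable ((\<lambda>s. s - t) ` {s. \<not> isCont g s})"
    using antimono_countable_discont[OF assms] by simp
  moreover have "{s. \<not> isCont g (s + t)} \<subseteq> (\<lambda>s. s - t) ` {s. \<not> isCont g s}"
    by (auto simp: image_iff intro!: exI[of _ "_ + t"])
  ultimately have "countable {s. \<not> isCont g (s + t)}" by (rule countable_subset[rotated])
  then show "{s. \<not> isCont g (s + t)} \<in> null_sets lborel" by (rule countable_imp_null_set_lborel)
qed auto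

section \<open>Brownian paths, the cost of a stopping time and the value function\<close>

locale control_problem = complete_measure M + prob_space M
  for M :: "'a measure" +
  fixes F :: "real \<Rightarrow> 'a measure" and W :: "real \<Rightarrow> 'a \<Rightarrow> real" and T \<sigma> \<rho> K \<alpha> x \<delta> :: real
  assumes T_pos: "0 < T" and \<sigma>_pos: "0 < \<sigma>" and \<rho>_pos: "0 < \<rho>" and K_pos: "0 < K"
    and usual: "usual_conditions M F T"
    and bm: "brownian_motion M F T W"
    and \<delta>_pos: "0 < \<delta>"
begin

text \<open>An element of \<open>E_set\<close> extended to the whole line, the setting of Helly's
  theorem; shifted times s + t then need no restriction.\<close>

definition profile :: "(real \<Rightarrow> real) \<Rightarrow> bool" where
  "profile g \<longleftrightarrow> antimono g \<and> (\<forall>s. continuous (at_right s) g) \<and> (\<forall>s. x - \<delta> \<le> g s \<and> g s \<le> x)"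

definition c :: real where "c = \<alpha> * (2 - \<alpha>)"

definition B :: real where "B = \<bar>x\<bar> + \<delta>"

lemma profile_antimono: "profile g \<Longrightarrow> antimono g"
  by (simp add: profile_def)

lemma profile_bound: "profile g \<Longrightarrow> \<bar>g s\<bar> \<le> B"
  using \<delta>_pos unfolding profile_def B_def abs_le_iff by (smt (verit))

lemma profile_measurable: "profile g \<Longrightarrow> g \<in> borel_measurable borel"
  by (simp add: profile_def antimono_borel_measurable)

definition path_ok :: "'a \<Rightarrow> bool" where
  "path_ok \<omega> \<longleftrightarrow> continuous_on {0..T} (\<lambda>t. W t \<omega>)"

text \<open>A version of W all of whose paths are continuous on the whole line, so that joint
  measurability and path integrals carry no exceptional set.\<close>

definition V :: "'a \<Rightarrow> real \<Rightarrow> real" where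
  "V \<omega> s = (if path_ok \<omega> then W (max 0 (min T s)) \<omega> else 0)"

lemma AE_path_ok: "AE \<omega> in M. path_ok \<omega>"
  using bm by (simp add: brownian_motion_def path_ok_def)

lemma V_eq: "path_ok \<omega> \<Longrightarrow> s \<in> {0..T} \<Longrightarrow> V \<omega> s = W s \<omega>"
  by (simp add: V_def)

lemma continuous_on_V: "continuous_on UNIV (V \<omega>)"
proof (cases "path_ok \<omega>")
  case True
  then have "continuous_on UNIV ((\<lambda>t. W t \<omega>) \<circ> (\<lambda>s. max 0 (min T s)))"
    using T_pos unfolding path_ok_def
    by (intro continuous_on_compose continuous_intros) (auto elim!: continuous_on_subset)
  moreover have "V \<omega> = (\<lambda>t. W t \<omega>) \<circ> (\<lambda>s. max 0 (min T s))"
    using True by (auto simp: V_def)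
  ultimately show ?thesis by simp
next
  case False
  then have "V \<omega> = (\<lambda>_. 0)" by (auto simp: V_def)
  then show ?thesis by simp
qed

lemma measurable_F: "f \<in> borel_measurable (F t) \<Longrightarrow> f \<in> borel_measurable M"
  by (rule measurable_from_subalg[of M "F t"]) (use usual in \<open>auto simp: usual_conditions_def\<close>)

lemma W_measurable: "t \<in> {0..T} \<Longrightarrow> W t \<in> borel_measurable M"
  using bm unfolding brownian_motion_def by (blast intro: measurable_F)

lemma V_measurable: "(\<lambda>\<omega>. V \<omega> s) \<in> borel_measurable M"
proof (rule borel_measurable_AE_eq)
  show "W (max 0 (min T s)) \<in> borel_measurable M" using T_pos by (intro W_measurable) auto
  show "AE \<omega> in M. V \<omega> s = W (max 0 (min T s)) \<omega>"
    using AE_path_ok by eventually_elim (simp add: V_def)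
qed

lemma V_measurable_pair[measurable]: "(\<lambda>(\<omega>, s). V \<omega> s) \<in> borel_measurable (M \<Otimes>\<^sub>M lborel)"
  by (rule borel_measurable_pair_continuous[OF V_measurable continuous_on_V])

lemma V_measurable_borel[measurable]: "V \<omega> \<in> borel_measurable borel"
  by (rule borel_measurable_continuous_onI[OF continuous_on_V])

lemma W_moments:
  assumes t: "t \<in> {0..T}"
  shows "integrable M (W t)" "expectation (W t) = 0" "expectation (\<lambda>\<omega>. \<bar>W t \<omega>\<bar>) \<le> 1 + T"
proof -
  have W0: "AE \<omega> in M. W 0 \<omega> = 0" using bm by (simp add: brownian_motion_def)
  have "integrable M (W t) \<and> expectation (W t) = 0 \<and> expectation (\<lambda>\<omega>. \<bar>W t \<omega>\<bar>) \<le> 1 + T"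
  proof (cases "t = 0")
    case True
    have m: "W 0 \<in> borel_measurable M" using W_measurable T_pos by auto
    have "integrable M (W 0)"
      by (subst integrable_cong_AE[where g = "\<lambda>_. 0"]) (use m W0 in auto)
    moreover have "expectation (W 0) = expectation (\<lambda>_. 0)"
      by (rule integral_cong_AE) (use m W0 in auto)
    moreover have "expectation (\<lambda>\<omega>. \<bar>W 0 \<omega>\<bar>) = expectation (\<lambda>_. 0)"
      by (rule integral_cong_AE) (use m W0 in auto)
    ultimately show ?thesis using True T_pos by simp
  next
    case False
    with t have t0: "0 < t" "t \<le> T" by auto
    \<comment> \<open>\<open>brownian_motion\<close> gives the law of increments only, and W 0 = 0
      only almost surely; the increment from time 0 replaces W t.\<close>
    define D where "D = (\<lambda>\<omega>. W t \<omega> - W 0 \<omega>)"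
    have m: "W t \<in> borel_measurable M" "D \<in> borel_measurable M"
      using W_measurable t T_pos by (auto simp: D_def)
    have dist: "distributed M lborel D (normal_density 0 (sqrt t))"
      using bm t0 unfolding brownian_motion_def D_def by force
    have D: "AE \<omega> in M. W t \<omega> = D \<omega>" using W0 by eventually_elim (simp add: D_def)
    have i1: "integrable M D"
      by (rule distributed_integrable[OF dist, THEN iffD1, of "\<lambda>x. x", simplified])
         (use t0 integrable_normal_moment_nz_1[of "sqrt t" 0] in auto)
    have i2: "integrable M (\<lambda>\<omega>. (D \<omega>)\<^sup>2)"
      by (rule distributed_integrable[OF dist, THEN iffD1, of "\<lambda>x. x\<^sup>2", simplified])
         (use t0 integrable_normal_moment[of "sqrt t" 0 2] in auto)
    have e1: "expectation D = 0" using normal_distributed_expectation[OF _ dist] t0 by simp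
    have e2: "expectation (\<lambda>\<omega>. (D \<omega>)\<^sup>2) = t" using normal_distributed_variance[OF _ dist] e1 t0 by simp
    have "expectation (\<lambda>\<omega>. \<bar>D \<omega>\<bar>) \<le> expectation (\<lambda>\<omega>. 1 + (D \<omega>)\<^sup>2)"
    proof (rule integral_mono)
      show "\<bar>D \<omega>\<bar> \<le> 1 + (D \<omega>)\<^sup>2" for \<omega>
        using sum_squares_bound[of 1 "\<bar>D \<omega>\<bar>"] by simp
    qed (use i1 i2 in auto)
    also have "\<dots> = 1 + t" using i2 e2 by (simp add: prob_space)
    finally have e3: "expectation (\<lambda>\<omega>. \<bar>D \<omega>\<bar>) \<le> 1 + t" .
    have "integrable M (W t)"
      by (subst integrable_cong_AE[where g = D]) (use m D i1 in auto)
    moreover have "expectation (W t) = expectation D"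
      by (rule integral_cong_AE) (use m D in auto)
    moreover have "expectation (\<lambda>\<omega>. \<bar>W t \<omega>\<bar>) = expectation (\<lambda>\<omega>. \<bar>D \<omega>\<bar>)"
      by (rule integral_cong_AE) (use m D in auto)
    ultimately show ?thesis using e1 e3 t0 by simp
  qed
  then show "integrable M (W t)" "expectation (W t) = 0" "expectation (\<lambda>\<omega>. \<bar>W t \<omega>\<bar>) \<le> 1 + T"
    by auto
qed

text \<open>The random part of one integrable bound for the payoffs of all profiles and all stopping
  times.\<close>

definition R :: "'a \<Rightarrow> real" where "R \<omega> = (LBINT s:{0..T}. \<bar>V \<omega> s\<bar>)"

lemma set_integrable_V: "r \<le> T \<Longrightarrow> set_integrable lborel {0..r} (\<lambda>s. f s * V \<omega> s)"
  if "continuous_on UNIV f" for f :: "real \<Rightarrow> real"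
  by (rule borel_integrable_atLeastAtMost')
     (auto intro!: continuous_intros continuous_on_subset[OF continuous_on_V] continuous_on_subset[OF that])

text \<open>Tonelli, with the bound 1 + T on the first absolute moment at each time.\<close>

lemma R_integrable: "integrable M R"
proof -
  interpret P: pair_sigma_finite M lborel ..
  have sV: "integrable lborel (\<lambda>s. indicat_real {0..T} s *\<^sub>R \<bar>V \<omega> s\<bar>)" for \<omega>
    using borel_integrable_atLeastAtMost'[of 0 T "\<lambda>s. \<bar>V \<omega> s\<bar>"]
    by (auto simp: set_integrable_def intro!: continuous_intros continuous_on_subset[OF continuous_on_V])
  have R: "ennreal (R \<omega>) = (\<integral>\<^sup>+ s. ennreal (indicat_real {0..T} s *\<^sub>R \<bar>V \<omega> s\<bar>) \<partial>lborel)" for \<omega>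
    unfolding R_def set_lebesgue_integral_def
    by (rule nn_integral_eq_integral[symmetric, OF sV]) auto
  have Rm: "R \<in> borel_measurable M"
    unfolding R_def set_lebesgue_integral_def by measurable
  have "(\<integral>\<^sup>+ \<omega>. ennreal (R \<omega>) \<partial>M) = (\<integral>\<^sup>+ s. (\<integral>\<^sup>+ \<omega>. ennreal (indicat_real {0..T} s *\<^sub>R \<bar>V \<omega> s\<bar>) \<partial>M) \<partial>lborel)"
    unfolding R by (rule P.Fubini'[symmetric]) measurable
  also have "\<dots> \<le> (\<integral>\<^sup>+ s. ennreal (1 + T) * indicator {0..T} s \<partial>lborel)"
  proof (rule nn_integral_mono)
    fix s :: real
    show "(\<integral>\<^sup>+ \<omega>. ennreal (indicat_real {0..T} s *\<^sub>R \<bar>V \<omega> s\<bar>) \<partial>M) \<le> ennreal (1 + T) * indicator {0..T} s"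
    proof (cases "s \<in> {0..T}")
      case True
      have "(\<integral>\<^sup>+ \<omega>. ennreal \<bar>V \<omega> s\<bar> \<partial>M) = (\<integral>\<^sup>+ \<omega>. ennreal \<bar>W s \<omega>\<bar> \<partial>M)"
        by (rule nn_integral_cong_AE) (use AE_path_ok V_eq True in \<open>auto elim!: eventually_mono\<close>)
      also have "\<dots> = ennreal (expectation (\<lambda>\<omega>. \<bar>W s \<omega>\<bar>))"
        by (rule nn_integral_eq_integral) (use W_moments(1)[OF True] in auto)
      also have "\<dots> \<le> ennreal (1 + T)" using W_moments(3)[OF True] by (rule ennreal_leI)
      finally show ?thesis using True by simp
    qed auto
  qed
  also have "\<dots> < \<infinity>"
    using T_pos by (simp add: nn_integral_cmult_indicator ennreal_mult_less_top)
  finally have "(\<integral>\<^sup>+ \<omega>. ennreal (R \<omega>) \<partial>M) < \<infinity>" .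
  moreover have "0 \<le> R \<omega>" for \<omega>
    unfolding R_def set_lebesgue_integral_def by (rule integral_nonneg_AE) auto
  ultimately show ?thesis
    using Rm by (intro integrableI_nonneg) auto
qed

text \<open>The path-independent part of the running cost. Start time, start point and profile enter
  the payoff \<open>P\<close> through \<open>G\<close> alone (\<open>P_decomp\<close>), so an
  inequality between \<open>G\<close>s is one between payoffs on every path.\<close>

definition G :: "real \<Rightarrow> real \<Rightarrow> (real \<Rightarrow> real) \<Rightarrow> real \<Rightarrow> real" where
  "G t y g r = (LBINT s:{0..r}. exp (- \<rho> * s) * (y - c * g (s + t)))"

definition P :: "real \<Rightarrow> real \<Rightarrow> (real \<Rightarrow> real) \<Rightarrow> real \<Rightarrow> 'a \<Rightarrow> real" where
  "P t y g r \<omega> = (LBINT s:{0..r}. exp (- \<rho> * s) * ((y + \<sigma> * V \<omega> s) - c * g (s + t))) + K * exp (- \<rho> * r)"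

lemma exp_le_1: "0 \<le> s \<Longrightarrow> exp (- \<rho> * s) \<le> 1"
  using \<rho>_pos by simp

lemma set_integrable_const_Icc: "set_integrable lborel {a..b} (\<lambda>_::real. k :: real)"
  by (rule borel_integrable_atLeastAtMost') (rule continuous_on_const)

lemma set_integrable_cost:
  assumes g: "profile g"
  shows "set_integrable lborel {0..r} (\<lambda>s. exp (- \<rho> * s) * (y - c * g (s + t)))"
proof (rule set_integrable_bound)
  show "set_integrable lborel {0..r} (\<lambda>_::real. \<bar>y\<bar> + \<bar>c\<bar> * B)"
    by (rule set_integrable_const_Icc)
  show "set_borel_measurable lborel {0..r} (\<lambda>s. exp (- \<rho> * s) * (y - c * g (s + t)))"
  proof -
    note [measurable] = profile_measurable[OF g]
    show ?thesis unfolding set_borel_measurable_def by measurable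
  qed
  have "norm (exp (- \<rho> * s) * (y - c * g (s + t))) \<le> norm (\<bar>y\<bar> + \<bar>c\<bar> * B)" if "0 \<le> s" for s
  proof -
    have "\<bar>c * g (s + t)\<bar> \<le> \<bar>c\<bar> * B"
      using profile_bound[OF g, of "s + t"] by (simp add: abs_mult mult_left_mono)
    then have "\<bar>y - c * g (s + t)\<bar> \<le> \<bar>y\<bar> + \<bar>c\<bar> * B" by linarith
    then have "exp (- \<rho> * s) * \<bar>y - c * g (s + t)\<bar> \<le> 1 * (\<bar>y\<bar> + \<bar>c\<bar> * B)"
      using exp_le_1[OF that] by (intro mult_mono) auto
    then show ?thesis by (simp add: abs_mult)
  qed
  then show "AE s in lborel. s \<in> {0..r} \<longrightarrow> norm (exp (- \<rho> * s) * (y - c * g (s + t))) \<le> norm (\<bar>y\<bar> + \<bar>c\<bar> * B)"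
    by auto
qed

lemma P_decomp:
  assumes "profile g" "r \<le> T"
  shows "P t y g r \<omega> = G t y g r + \<sigma> * (LBINT s:{0..r}. exp (- \<rho> * s) * V \<omega> s) + K * exp (- \<rho> * r)"
proof -
  have "(LBINT s:{0..r}. exp (- \<rho> * s) * ((y + \<sigma> * V \<omega> s) - c * g (s + t)))
    = (LBINT s:{0..r}. exp (- \<rho> * s) * (y - c * g (s + t)) + \<sigma> * (exp (- \<rho> * s) * V \<omega> s))"
    by (simp add: algebra_simps)
  also have "\<dots> = G t y g r + (LBINT s:{0..r}. \<sigma> * (exp (- \<rho> * s) * V \<omega> s))"
    unfolding G_def by (intro set_integral_add set_integrable_cost assms set_integrable_mult_right set_integrable_V)
      (auto intro!: continuous_intros assms)
  finally show ?thesis by (simp add: P_def)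
qed

lemma P_measurable:
  assumes g: "profile g" and [measurable]: "\<tau> \<in> borel_measurable M"
  shows "(\<lambda>\<omega>. P t y g (\<tau> \<omega>) \<omega>) \<in> borel_measurable M"
  \<comment> \<open>Unfolding the indicator turns the random upper limit into a jointly measurable
    condition on \<omega> and s.\<close>
  using profile_measurable[OF g, measurable] unfolding P_def set_lebesgue_integral_def indicator_def atLeastAtMost_iff by measurable

lemma cost_bound:
  assumes g: "profile g" and s: "0 \<le> s"
  shows "\<bar>exp (- \<rho> * s) * ((y + \<sigma> * V \<omega> s) - c * g u)\<bar> \<le> \<sigma> * \<bar>V \<omega> s\<bar> + (\<bar>y\<bar> + \<bar>c\<bar> * B)"
proof -
  have "\<bar>c * g u\<bar> \<le> \<bar>c\<bar> * B"
    using profile_bound[OF g, of u] by (simp add: abs_mult mult_left_mono)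
  moreover have "\<bar>\<sigma> * V \<omega> s\<bar> = \<sigma> * \<bar>V \<omega> s\<bar>" using \<sigma>_pos by (simp add: abs_mult)
  ultimately have le: "\<bar>(y + \<sigma> * V \<omega> s) - c * g u\<bar> \<le> \<sigma> * \<bar>V \<omega> s\<bar> + (\<bar>y\<bar> + \<bar>c\<bar> * B)" by linarith
  have "\<bar>exp (- \<rho> * s) * ((y + \<sigma> * V \<omega> s) - c * g u)\<bar> \<le> 1 * (\<sigma> * \<bar>V \<omega> s\<bar> + (\<bar>y\<bar> + \<bar>c\<bar> * B))"
    unfolding abs_mult by (intro mult_mono) (use exp_le_1[OF s] le in auto)
  then show ?thesis by simp
qed

lemma set_integrable_abs_V: "set_integrable lborel {0..T} (\<lambda>s. \<bar>V \<omega> s\<bar>)"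
  by (rule borel_integrable_atLeastAtMost')
     (auto intro!: continuous_intros continuous_on_subset[OF continuous_on_V])

lemma set_integrable_cost_bound: "set_integrable lborel {0..T} (\<lambda>s. \<sigma> * \<bar>V \<omega> s\<bar> + k)"
  by (intro set_integral_add set_integrable_mult_right set_integrable_const_Icc set_integrable_abs_V)

lemma P_bound:
  assumes g: "profile g" and r: "0 \<le> r" "r \<le> T"
  shows "\<bar>P t y g r \<omega>\<bar> \<le> \<sigma> * R \<omega> + T * (\<bar>y\<bar> + \<bar>c\<bar> * B) + K"
proof -
  let ?f = "\<lambda>s. exp (- \<rho> * s) * ((y + \<sigma> * V \<omega> s) - c * g (s + t))"
  let ?b = "\<lambda>s. \<sigma> * \<bar>V \<omega> s\<bar> + (\<bar>y\<bar> + \<bar>c\<bar> * B)"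
  have "norm (LBINT s:{0..r}. ?f s) \<le> (LBINT s:{0..T}. ?b s)"
    unfolding set_lebesgue_integral_def
  proof (rule Bochner_Integration.integral_norm_bound_integral)
    have "set_integrable lborel {0..r} (\<lambda>s. exp (- \<rho> * s) * (y - c * g (s + t)) + \<sigma> * (exp (- \<rho> * s) * V \<omega> s))"
      by (intro set_integral_add set_integrable_cost g set_integrable_mult_right set_integrable_V)
        (auto intro!: continuous_intros r)
    then show "integrable lborel (\<lambda>s. indicat_real {0..r} s *\<^sub>R ?f s)"
      by (simp add: set_integrable_def algebra_simps)
    show "integrable lborel (\<lambda>s. indicat_real {0..T} s *\<^sub>R ?b s)"
      using set_integrable_cost_bound by (simp add: set_integrable_def)
    fix s :: real
    have "0 \<le> ?b s" using \<sigma>_pos \<delta>_pos by (simp add: B_def)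
    then show "norm (indicat_real {0..r} s *\<^sub>R ?f s) \<le> indicat_real {0..T} s *\<^sub>R ?b s"
      using r cost_bound[OF g, of s y \<omega> "s + t"] by (auto simp: indicator_def)
  qed
  also have "(LBINT s:{0..T}. ?b s) = \<sigma> * R \<omega> + T * (\<bar>y\<bar> + \<bar>c\<bar> * B)"
    using T_pos unfolding R_def
    by (subst set_integral_add) (auto simp: set_integral_const set_integrable_const_Icc set_integrable_abs_V algebra_simps)
  finally have "\<bar>LBINT s:{0..r}. ?f s\<bar> \<le> \<sigma> * R \<omega> + T * (\<bar>y\<bar> + \<bar>c\<bar> * B)" by simp
  moreover have "0 \<le> K * exp (- \<rho> * r)" "K * exp (- \<rho> * r) \<le> K"
    using exp_le_1[OF r(1)] K_pos by (simp, simp add: mult_left_le)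
  ultimately show ?thesis unfolding P_def by linarith
qed

abbreviation ST :: "real \<Rightarrow> ('a \<Rightarrow> real) set" where "ST t \<equiv> stopping_times M F T t"

lemma ST_measurable: "\<tau> \<in> ST t \<Longrightarrow> \<tau> \<in> borel_measurable M"
  using usual by (auto simp: stopping_times_def usual_conditions_def subalgebra_def intro!: measurable_stopping_time)

lemma ST_range: "\<tau> \<in> ST t \<Longrightarrow> \<omega> \<in> space M \<Longrightarrow> 0 \<le> \<tau> \<omega> \<and> \<tau> \<omega> \<le> T - t"
  by (auto simp: stopping_times_def)

lemma P_integrable:
  assumes "profile g" "\<tau> \<in> ST t'" "0 \<le> t'"
  shows "integrable M (\<lambda>\<omega>. P t y g (\<tau> \<omega>) \<omega>)"
proof (rule Bochner_Integration.integrable_bound)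
  show "integrable M (\<lambda>\<omega>. \<sigma> * R \<omega> + T * (\<bar>y\<bar> + \<bar>c\<bar> * B) + K)" using R_integrable by simp
  show "(\<lambda>\<omega>. P t y g (\<tau> \<omega>) \<omega>) \<in> borel_measurable M" using assms by (intro P_measurable ST_measurable)
  show "AE \<omega> in M. norm (P t y g (\<tau> \<omega>) \<omega>) \<le> norm (\<sigma> * R \<omega> + T * (\<bar>y\<bar> + \<bar>c\<bar> * B) + K)"
  proof (rule AE_I2)
    fix \<omega> assume "\<omega> \<in> space M"
    then have "0 \<le> \<tau> \<omega>" "\<tau> \<omega> \<le> T" using ST_range[OF assms(2)] assms(3) by fastforce+
    from P_bound[OF assms(1) this, of t y \<omega>] show "norm (P t y g (\<tau> \<omega>) \<omega>) \<le> norm (\<sigma> * R \<omega> + T * (\<bar>y\<bar> + \<bar>c\<bar> * B) + K)"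
      by simp
  qed
qed

abbreviation v where "v g t y \<equiv> value_fun M F W T \<sigma> \<rho> K \<alpha> g t y"

text \<open>The integrands agree on good paths because \<tau> <= T - t <= T. The one written with W
  is measurable only by completeness.\<close>

lemma value_eq:
  assumes g: "profile g" and t: "t \<in> {0..T}"
  shows "v g t y = (INF \<tau>\<in>ST t. expectation (\<lambda>\<omega>. P t y g (\<tau> \<omega>) \<omega>))"
  unfolding value_fun_def
proof (rule INF_cong[OF refl])
  fix \<tau> assume \<tau>: "\<tau> \<in> ST t"
  let ?Q = "\<lambda>\<omega>. (LBINT s:{0..\<tau> \<omega>}. exp (- \<rho> * s) * ((y + \<sigma> * W s \<omega>) - \<alpha> * (2 - \<alpha>) * g (s + t))) + K * exp (- \<rho> * \<tau> \<omega>)"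
  have m: "(\<lambda>\<omega>. P t y g (\<tau> \<omega>) \<omega>) \<in> borel_measurable M"
    by (intro P_measurable g ST_measurable[OF \<tau>])
  have eq: "AE \<omega> in M. ?Q \<omega> = P t y g (\<tau> \<omega>) \<omega>"
    using AE_path_ok AE_space
  proof eventually_elim
    case (elim \<omega>)
    then have "\<tau> \<omega> \<le> T" using ST_range[OF \<tau>] t by fastforce
    then show ?case using elim(1) unfolding P_def c_def
      by (intro arg_cong2[where f = "(+)"] refl set_lebesgue_integral_cong) (auto simp: V_eq)
  qed
  show "expectation ?Q = expectation (\<lambda>\<omega>. P t y g (\<tau> \<omega>) \<omega>)"
    by (rule integral_cong_AE[OF borel_measurable_AE_eq[OF m eq] m eq])
qed

text \<open>A real infimum is a greatest lower bound only for a nonempty set bounded below; \<tau> =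
  0 and \<open>P_bound\<close> supply this.\<close>

lemma le_value_iff:
  assumes g: "profile g" and t: "t \<in> {0..T}"
  shows "u \<le> v g t y \<longleftrightarrow> (\<forall>\<tau>\<in>ST t. u \<le> expectation (\<lambda>\<omega>. P t y g (\<tau> \<omega>) \<omega>))"
  unfolding value_eq[OF assms]
proof (rule le_cINF_iff)
  show "ST t \<noteq> {}"
    using t by (auto simp: stopping_times_def intro!: exI[of _ "\<lambda>_. 0"] stopping_time_const)
  show "bdd_below ((\<lambda>\<tau>. expectation (\<lambda>\<omega>. P t y g (\<tau> \<omega>) \<omega>)) ` ST t)"
  proof (rule bdd_belowI2)
    fix \<tau> assume \<tau>: "\<tau> \<in> ST t"
    let ?b = "\<lambda>\<omega>. - (\<sigma> * R \<omega> + T * (\<bar>y\<bar> + \<bar>c\<bar> * B) + K)"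
    show "expectation ?b \<le> expectation (\<lambda>\<omega>. P t y g (\<tau> \<omega>) \<omega>)"
    proof (rule integral_mono)
      show "integrable M ?b" using R_integrable by (intro integrable_minus integrable_add) auto
      show "integrable M (\<lambda>\<omega>. P t y g (\<tau> \<omega>) \<omega>)" using t by (intro P_integrable[OF g \<tau>]) auto
      fix \<omega> assume "\<omega> \<in> space M"
      then have "0 \<le> \<tau> \<omega>" "\<tau> \<omega> \<le> T" using ST_range[OF \<tau>] t by fastforce+
      from P_bound[OF g this, of t y \<omega>] show "?b \<omega> \<le> P t y g (\<tau> \<omega>) \<omega>" by linarith
    qed
  qed
qed

lemma ST_mono: "t \<le> t' \<Longrightarrow> ST t' \<subseteq> ST t"
  by (force simp: stopping_times_def)

text \<open>For t <= t' a stopping time admissible at t' is admissible at t, and for it the Brownian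
  integral and the stopping cost coincide in both payoffs.\<close>

lemma value_comparison:
  assumes g: "profile g" "profile g'" and t: "0 \<le> t" "t \<le> t'" "t' \<le> T"
    and le: "\<And>r. 0 \<le> r \<Longrightarrow> r \<le> T - t' \<Longrightarrow> G t y g r \<le> G t' y' g' r"
    and K: "K \<le> v g t y"
  shows "K \<le> v g' t' y'"
proof -
  have "K \<le> expectation (\<lambda>\<omega>. P t' y' g' (\<tau> \<omega>) \<omega>)" if \<tau>: "\<tau> \<in> ST t'" for \<tau>
  proof -
    have "K \<le> expectation (\<lambda>\<omega>. P t y g (\<tau> \<omega>) \<omega>)"
      using K ST_mono[OF t(2)] \<tau> t le_value_iff[OF g(1), of t K y] by auto
    also have "\<dots> \<le> expectation (\<lambda>\<omega>. P t' y' g' (\<tau> \<omega>) \<omega>)"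
    proof (rule integral_mono)
      fix \<omega> assume "\<omega> \<in> space M"
      then have r: "0 \<le> \<tau> \<omega>" "\<tau> \<omega> \<le> T - t'" "\<tau> \<omega> \<le> T" using ST_range[OF \<tau>] t by fastforce+
      show "P t y g (\<tau> \<omega>) \<omega> \<le> P t' y' g' (\<tau> \<omega>) \<omega>"
        using le[OF r(1,2)] r(3) by (simp add: P_decomp g)
    qed (use t in \<open>auto intro!: P_integrable g \<tau>\<close>)
    finally show ?thesis .
  qed
  then show ?thesis using t by (subst le_value_iff[OF g(2)]) auto
qed

section \<open>Stability of the value function\<close>

text \<open>Dominated convergence in time: a monotone profile has countably many jumps, and the
  moving end point affects only s = r in the limit; both are null sets.\<close>

lemma P_tendsto:
  assumes g: "profile g" "\<And>n. profile (gs n)" and lim: "weak_lim gs g"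
    and tn: "tn \<longlonglongrightarrow> t" and rn: "rn \<longlonglongrightarrow> r" "\<And>n. 0 \<le> rn n \<and> rn n \<le> T"
  shows "(\<lambda>n. P (tn n) y (gs n) (rn n) \<omega>) \<longlonglongrightarrow> P t y g r \<omega>"
  unfolding P_def set_lebesgue_integral_def
proof (intro tendsto_add tendsto_intros rn)
  let ?f = "\<lambda>t g s. exp (- \<rho> * s) * ((y + \<sigma> * V \<omega> s) - c * g (s + t))"
  let ?b = "\<lambda>s. \<sigma> * \<bar>V \<omega> s\<bar> + (\<bar>y\<bar> + \<bar>c\<bar> * B)"
  note [measurable] = profile_measurable[OF g(1)] profile_measurable[OF g(2)]
  show "(\<lambda>n. LBINT s. indicat_real {0..rn n} s *\<^sub>R ?f (tn n) (gs n) s)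
    \<longlonglongrightarrow> (LBINT s. indicat_real {0..r} s *\<^sub>R ?f t g s)"
  proof (rule integral_dominated_convergence[where w = "\<lambda>s. indicat_real {0..T} s *\<^sub>R ?b s"])
    show "integrable lborel (\<lambda>s. indicat_real {0..T} s *\<^sub>R ?b s)"
      using set_integrable_cost_bound by (simp add: set_integrable_def)
    show "AE s in lborel. (\<lambda>n. indicat_real {0..rn n} s *\<^sub>R ?f (tn n) (gs n) s)
        \<longlonglongrightarrow> indicat_real {0..r} s *\<^sub>R ?f t g s"
      using AE_isCont_shift[OF profile_antimono[OF g(1)], of t] AE_lborel_singleton[of r]
    proof eventually_elim
      case (elim s)
      have "(\<lambda>n. s + tn n) \<longlonglongrightarrow> s + t" using tn by (intro tendsto_intros)
      then have "(\<lambda>n. gs n (s + tn n)) \<longlonglongrightarrow> g (s + t)"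
        by (rule weak_lim_shift[OF profile_antimono[OF g(1)] profile_antimono[OF g(2)] lim elim(1)])
      then have "(\<lambda>n. ?f (tn n) (gs n) s) \<longlonglongrightarrow> ?f t g s" by (intro tendsto_intros)
      moreover have "(\<lambda>n. indicat_real {0..rn n} s) \<longlonglongrightarrow> indicat_real {0..r} s"
      proof (rule tendsto_eventually)
        consider "s < r" | "r < s" using elim by linarith
        then show "\<forall>\<^sub>F n in sequentially. indicat_real {0..rn n} s = indicat_real {0..r} s"
        proof cases
          case 1
          then have "\<forall>\<^sub>F n in sequentially. s < rn n" using rn(1) by (intro order_tendstoD)
          then show ?thesis by eventually_elim (use 1 in \<open>auto simp: indicator_def\<close>)
        next
          case 2
          then have "\<forall>\<^sub>F n in sequentially. rn n < s" using rn(1) by (intro order_tendstoD)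
          then show ?thesis by eventually_elim (use 2 in \<open>auto simp: indicator_def\<close>)
        qed
      qed
      ultimately show ?case by (rule tendsto_scaleR[rotated])
    qed
    show "AE s in lborel. norm (indicat_real {0..rn n} s *\<^sub>R ?f (tn n) (gs n) s) \<le> indicat_real {0..T} s *\<^sub>R ?b s" for n
    proof (rule AE_I2)
      fix s
      have "0 \<le> ?b s" using \<sigma>_pos \<delta>_pos by (simp add: B_def)
      then show "norm (indicat_real {0..rn n} s *\<^sub>R ?f (tn n) (gs n) s) \<le> indicat_real {0..T} s *\<^sub>R ?b s"
        using rn(2)[of n] cost_bound[OF g(2)[of n], of s y \<omega> "s + tn n"] by (auto simp: indicator_def)
    qed
  qed measurable
qed

lemma value_less_eventually:
  assumes g: "profile g" "\<And>n. profile (gs n)" and lim: "weak_lim gs g"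
    and tn: "tn \<longlonglongrightarrow> t" "\<And>n. 0 \<le> tn n \<and> tn n < T" and t: "0 \<le> t" "t < T"
    and less: "v g t y < K"
  shows "\<forall>\<^sub>F n in sequentially. v (gs n) (tn n) y < K"
proof -
  have "\<not> K \<le> v g t y" using less by simp
  then obtain \<tau> where \<tau>: "\<tau> \<in> ST t" and J: "expectation (\<lambda>\<omega>. P t y g (\<tau> \<omega>) \<omega>) < K"
    using le_value_iff[OF g(1), of t K y] t by force
  \<comment> \<open>Truncation makes the good stopping time admissible for the horizon T -
    \<open>tn n\<close>; since \<tau> <= T - t, the truncated times converge back to \<tau>.\<close>
  define \<tau>n where "\<tau>n n \<omega> = min (\<tau> \<omega>) (T - tn n)" for n \<omega>
  have \<tau>n: "\<tau>n n \<in> ST (tn n)" for n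
    using \<tau> tn(2)[of n] unfolding stopping_times_def \<tau>n_def
    by (auto intro!: stopping_time_min stopping_time_const simp: less_imp_le)
  have "(\<lambda>n. expectation (\<lambda>\<omega>. P (tn n) y (gs n) (\<tau>n n \<omega>) \<omega>)) \<longlonglongrightarrow> expectation (\<lambda>\<omega>. P t y g (\<tau> \<omega>) \<omega>)"
  proof (rule integral_dominated_convergence[where w = "\<lambda>\<omega>. \<sigma> * R \<omega> + T * (\<bar>y\<bar> + \<bar>c\<bar> * B) + K"])
    show "(\<lambda>\<omega>. P t y g (\<tau> \<omega>) \<omega>) \<in> borel_measurable M"
      by (intro P_measurable g ST_measurable[OF \<tau>])
    show "(\<lambda>\<omega>. P (tn n) y (gs n) (\<tau>n n \<omega>) \<omega>) \<in> borel_measurable M" for n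
      by (intro P_measurable g ST_measurable[OF \<tau>n])
    show "integrable M (\<lambda>\<omega>. \<sigma> * R \<omega> + T * (\<bar>y\<bar> + \<bar>c\<bar> * B) + K)" using R_integrable by simp
    have range: "0 \<le> \<tau>n n \<omega> \<and> \<tau>n n \<omega> \<le> T" if "\<omega> \<in> space M" for n \<omega>
      using ST_range[OF \<tau>n that, of n] tn(2)[of n] by auto
    show "AE \<omega> in M. norm (P (tn n) y (gs n) (\<tau>n n \<omega>) \<omega>) \<le> \<sigma> * R \<omega> + T * (\<bar>y\<bar> + \<bar>c\<bar> * B) + K" for n
      using range P_bound[OF g(2)] by (intro AE_I2) auto
    show "AE \<omega> in M. (\<lambda>n. P (tn n) y (gs n) (\<tau>n n \<omega>) \<omega>) \<longlonglongrightarrow> P t y g (\<tau> \<omega>) \<omega>"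
    proof (intro AE_I2 P_tendsto g lim tn(1))
      fix \<omega> assume \<omega>: "\<omega> \<in> space M"
      have "(\<lambda>n. \<tau>n n \<omega>) \<longlonglongrightarrow> min (\<tau> \<omega>) (T - t)" unfolding \<tau>n_def by (intro tendsto_intros tn(1))
      then show "(\<lambda>n. \<tau>n n \<omega>) \<longlonglongrightarrow> \<tau> \<omega>" using ST_range[OF \<tau> \<omega>] by (simp add: min_absorb1)
      show "0 \<le> \<tau>n n \<omega> \<and> \<tau>n n \<omega> \<le> T" for n using range[OF \<omega>] .
    qed
  qed
  then have "\<forall>\<^sub>F n in sequentially. expectation (\<lambda>\<omega>. P (tn n) y (gs n) (\<tau>n n \<omega>) \<omega>) < K"
    using J by (rule order_tendstoD)
  then show ?thesis
  proof eventually_elim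
    case (elim n)
    then have "\<not> K \<le> v (gs n) (tn n) y"
      using le_value_iff[OF g(2)[of n], of "tn n" K y] \<tau>n[of n] tn(2)[of n] by force
    then show ?case by simp
  qed
qed

lemma G_mono:
  assumes g: "profile g" "profile g'"
    and le: "\<And>s. 0 \<le> s \<Longrightarrow> s \<le> r \<Longrightarrow> y - c * g (s + t) \<le> y' - c * g' (s + t')"
  shows "G t y g r \<le> G t' y' g' r"
  unfolding G_def
  by (intro set_integral_mono set_integrable_cost g) (auto intro!: mult_left_mono le)

text \<open>Raising the starting point by e offsets, at each instant, a change of profile that
  increases \<open>c\<close> g by at most e. This is the source of both monotonicity and the
  Lipschitz bound.\<close>

lemma value_shift:
  assumes g: "profile g" "profile g'" and t: "t \<in> {0..T}" and K: "K \<le> v g t y"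
    and le: "\<And>s. s \<in> {0..T} \<Longrightarrow> c * (g' s - g s) \<le> e" "y + e \<le> y'"
  shows "K \<le> v g' t y'"
proof (rule value_comparison[OF g _ order_refl _ _ K])
  fix r assume r: "0 \<le> r" "r \<le> T - t"
  show "G t y g r \<le> G t y' g' r"
  proof (rule G_mono[OF g])
    fix s assume "0 \<le> s" "s \<le> r"
    then have "c * (g' (s + t) - g (s + t)) \<le> e" using t r by (intro le) auto
    then show "y - c * g (s + t) \<le> y' - c * g' (s + t)" using le(2) by (simp add: algebra_simps)
  qed
qed (use t in auto)

text \<open>If the two profiles differ little just after \<open>t\<close>, raising \<open>y\<close> by \<open>e\<close> pays for that
  difference pathwise at every instant, and what is collected this way on the first \<open>\<eta>\<close> units of time
  pays for the rest, which is small in the mean.\<close>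

lemma value_ge_eventually:
  assumes g: "profile g" "\<And>n. profile (gs n)" and lim: "weak_lim gs g"
    and tn: "tn \<longlonglongrightarrow> t" "\<And>n. t \<le> tn n \<and> tn n < T" and t: "0 \<le> t" "t < T"
    and \<eta>: "0 < \<eta>" and e: "0 < e"
    and close: "\<forall>\<^sub>F n in sequentially. \<forall>s\<in>{0..\<eta>}. \<bar>c\<bar> * \<bar>gs n (s + tn n) - g (s + t)\<bar> \<le> e / 2"
    and K: "K \<le> v g t y"
  shows "\<forall>\<^sub>F n in sequentially. K \<le> v (gs n) (tn n) (y + e)"
proof -
  note [measurable] = profile_measurable[OF g(1)] profile_measurable[OF g(2)]
  define d where "d n s = \<bar>gs n (s + tn n) - g (s + t)\<bar>" for n s
  have d_bound: "0 \<le> d n s" "d n s \<le> 2 * B" for n s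
    using profile_bound[OF g(1), of "s + t"] profile_bound[OF g(2), of n "s + tn n"] by (auto simp: d_def)
  have d_int: "set_integrable lborel {0..r} (d n)" for n r
  proof (rule set_integrable_bound[OF set_integrable_const_Icc[of 0 r "2 * B"]])
    show "set_borel_measurable lborel {0..r} (d n)"
      unfolding set_borel_measurable_def d_def by measurable
    have "norm (d n s) \<le> norm (2 * B)" for s
      using d_bound[of n s] by simp
    then show "AE s in lborel. s \<in> {0..r} \<longrightarrow> norm (d n s) \<le> norm (2 * B)" by simp
  qed
  \<comment> \<open>No uniform closeness is available beyond \<eta>, but the distance vanishes in
    the mean.\<close>
  have D: "(\<lambda>n. LBINT s:{0..T}. d n s) \<longlonglongrightarrow> (LBINT s:{0..T}. 0)"
    unfolding set_lebesgue_integral_def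
  proof (rule integral_dominated_convergence[where w = "\<lambda>s. indicat_real {0..T} s *\<^sub>R (2 * B)"])
    show "integrable lborel (\<lambda>s. indicat_real {0..T} s *\<^sub>R (2 * B))"
      using set_integrable_const_Icc[of 0 T "2 * B"] by (simp add: set_integrable_def)
    show "AE s in lborel. (\<lambda>n. indicat_real {0..T} s *\<^sub>R d n s) \<longlonglongrightarrow> indicat_real {0..T} s *\<^sub>R 0"
      using AE_isCont_shift[OF profile_antimono[OF g(1)], of t]
    proof eventually_elim
      case (elim s)
      have "(\<lambda>n. s + tn n) \<longlonglongrightarrow> s + t" using tn by (intro tendsto_intros)
      then have "(\<lambda>n. gs n (s + tn n)) \<longlonglongrightarrow> g (s + t)"
        by (rule weak_lim_shift[OF profile_antimono[OF g(1)] profile_antimono[OF g(2)] lim elim(1)])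
      then have "(\<lambda>n. d n s) \<longlonglongrightarrow> \<bar>g (s + t) - g (s + t)\<bar>" unfolding d_def by (intro tendsto_intros)
      then show ?case by (intro tendsto_intros) simp
    qed
    show "AE s in lborel. norm (indicat_real {0..T} s *\<^sub>R d n s) \<le> indicat_real {0..T} s *\<^sub>R (2 * B)" for n
      using d_bound by (auto simp: indicator_def)
  qed (unfold d_def, measurable)
  \<comment> \<open>Of the raise e, at least e/2 is left over near time 0; discounted by at worst
    exp(-\<rho>T) this is a surplus of \<kappa> per unit of time, hence \<kappa>\<eta>' on
    [0,\<eta>'].\<close>
  define \<kappa> where "\<kappa> = exp (- \<rho> * T) * (e / 2)"
  define \<eta>' where "\<eta>' = min \<eta> T"
  have pos: "0 < \<kappa>" "0 < \<eta>'" using e \<eta> T_pos by (auto simp: \<kappa>_def \<eta>'_def)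
  have "(\<lambda>n. \<bar>c\<bar> * (LBINT s:{0..T}. d n s)) \<longlonglongrightarrow> \<bar>c\<bar> * (LBINT s:{0..T}. 0)"
    by (intro tendsto_intros D)
  then have "\<forall>\<^sub>F n in sequentially. \<bar>c\<bar> * (LBINT s:{0..T}. d n s) < \<kappa> * \<eta>'"
    using pos by (intro order_tendstoD(2)[where y = 0]) auto
  with close show ?thesis
  proof eventually_elim
    case (elim n)
    define \<phi> where "\<phi> s = exp (- \<rho> * s) * (y + e - c * gs n (s + tn n)) - exp (- \<rho> * s) * (y - c * g (s + t))" for s
    have \<phi>_eq: "\<phi> s = exp (- \<rho> * s) * (e - c * (gs n (s + tn n) - g (s + t)))" for s
      by (simp add: \<phi>_def algebra_simps)
    have cd: "c * (gs n (s + tn n) - g (s + t)) \<le> \<bar>c\<bar> * d n s" for s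
      unfolding d_def abs_mult[symmetric] by simp
    have \<phi>_int: "set_integrable lborel {0..r} \<phi>" for r
      unfolding \<phi>_def by (intro set_integral_diff set_integrable_cost g)
    have near: "\<kappa> \<le> \<phi> s" if "s \<in> {0..\<eta>'}" for s
    proof -
      have "\<bar>c\<bar> * d n s \<le> e / 2" using elim(1) that by (auto simp: d_def \<eta>'_def)
      then have "e / 2 \<le> e - c * (gs n (s + tn n) - g (s + t))" using cd[of s] by linarith
      moreover have "exp (- \<rho> * T) \<le> exp (- \<rho> * s)" using that \<rho>_pos by (simp add: \<eta>'_def)
      ultimately show ?thesis unfolding \<phi>_eq \<kappa>_def using e by (intro mult_mono) auto
    qed
    have far: "- (\<bar>c\<bar> * d n s) \<le> \<phi> s" if "0 \<le> s" for s
    proof -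
      have "exp (- \<rho> * s) * (\<bar>c\<bar> * d n s) \<le> 1 * (\<bar>c\<bar> * d n s)"
        using exp_le_1[OF that] d_bound by (intro mult_right_mono) auto
      moreover have "exp (- \<rho> * s) * (- (\<bar>c\<bar> * d n s)) \<le> \<phi> s"
        unfolding \<phi>_eq using cd[of s] e by (intro mult_left_mono) auto
      ultimately show ?thesis by simp
    qed
    have int_\<phi>: "0 \<le> (LBINT s:{0..r}. \<phi> s)" if r: "0 \<le> r" "r \<le> T - tn n" for r
    proof (cases "r \<le> \<eta>'")
      case True
      have "(LBINT s:{0..r}. 0) \<le> (LBINT s:{0..r}. \<phi> s)"
      proof (rule set_integral_mono)
        show "0 \<le> \<phi> s" if "s \<in> {0..r}" for s
          using near[of s] pos that True by auto
      qed (rule \<phi>_int set_integrable_const_Icc)+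
      then show ?thesis by simp
    next
      case False
      have rT: "r \<le> T" using r t tn(2)[of n] by auto
      have i1: "set_integrable lborel {0..r} (\<lambda>s. indicat_real {0..\<eta>'} s * \<kappa>)"
      proof -
        have "indicat_real {0..r} s *\<^sub>R (indicat_real {0..\<eta>'} s * \<kappa>) = indicat_real {0..\<eta>'} s *\<^sub>R \<kappa>" for s
          using False by (auto simp: indicator_def)
        then show ?thesis using set_integrable_const_Icc[of 0 \<eta>' \<kappa>] unfolding set_integrable_def by (simp only:)
      qed
      have i2: "set_integrable lborel {0..r} (\<lambda>s. \<bar>c\<bar> * d n s)" by (intro set_integrable_mult_right d_int)
      have "(LBINT s:{0..r}. indicat_real {0..\<eta>'} s * \<kappa>) = (LBINT s:{0..\<eta>'}. \<kappa>)"
        unfolding set_lebesgue_integral_def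
        by (rule Bochner_Integration.integral_cong) (use False in \<open>auto simp: indicator_def\<close>)
      also have "\<dots> = \<kappa> * \<eta>'" using pos by (simp add: set_integral_const)
      finally have e1: "(LBINT s:{0..r}. indicat_real {0..\<eta>'} s * \<kappa>) = \<kappa> * \<eta>'" .
      have "(LBINT s:{0..r}. d n s) \<le> (LBINT s:{0..T}. d n s)"
        unfolding set_lebesgue_integral_def
        by (rule integral_mono) (use d_int d_bound rT in \<open>auto simp: set_integrable_def indicator_def\<close>)
      then have "(LBINT s:{0..r}. \<bar>c\<bar> * d n s) \<le> \<bar>c\<bar> * (LBINT s:{0..T}. d n s)"
        by (simp add: mult_left_mono)
      then have "0 \<le> (LBINT s:{0..r}. indicat_real {0..\<eta>'} s * \<kappa> - \<bar>c\<bar> * d n s)"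
        using elim(2) by (subst set_integral_diff(2)[OF i1 i2]) (use e1 in linarith)
      also have "\<dots> \<le> (LBINT s:{0..r}. \<phi> s)"
      proof (rule set_integral_mono)
        show "set_integrable lborel {0..r} (\<lambda>s. indicat_real {0..\<eta>'} s * \<kappa> - \<bar>c\<bar> * d n s)"
          by (rule set_integral_diff(1)[OF i1 i2])
        fix s assume s: "s \<in> {0..r}"
        have "0 \<le> \<bar>c\<bar> * d n s" using d_bound by simp
        then show "indicat_real {0..\<eta>'} s * \<kappa> - \<bar>c\<bar> * d n s \<le> \<phi> s"
          using near[of s] far[of s] s by (cases "s \<in> {0..\<eta>'}") (auto simp: indicator_def)
      qed (rule \<phi>_int)
      finally show ?thesis .
    qed
    have le: "G t y g r \<le> G (tn n) (y + e) (gs n) r" if "0 \<le> r" "r \<le> T - tn n" for r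
      using int_\<phi>[OF that] unfolding G_def \<phi>_def
        set_integral_diff(2)[OF set_integrable_cost[OF g(2)] set_integrable_cost[OF g(1)]] by simp
    \<comment> \<open>Here t <= \<open>tn n\<close> enters: the comparison runs from an earlier to a
      later starting time.\<close>
    show ?case
      by (rule value_comparison[OF g(1) g(2)[of n] _ _ _ _ K]) (use t tn(2)[of n] le in auto)
  qed
qed

section \<open>The free boundary and the control\<close>

abbreviation b :: "(real \<Rightarrow> real) \<Rightarrow> real \<Rightarrow> ereal" where
  "b g t \<equiv> free_boundary M F W T \<sigma> \<rho> K \<alpha> g t"

abbreviation \<xi> :: "(real \<Rightarrow> real) \<Rightarrow> real \<Rightarrow> 'a \<Rightarrow> ereal" where
  "\<xi> g t \<omega> \<equiv> opt_control M F W T \<sigma> \<rho> K \<alpha> x g t \<omega>"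

definition Z :: "(real \<Rightarrow> real) \<Rightarrow> 'a \<Rightarrow> real \<Rightarrow> ereal" where
  "Z g \<omega> s = max 0 (ereal (x + \<sigma> * W s \<omega>) - b g s)"

lemma \<xi>_eq: "\<xi> g t \<omega> = (SUP s\<in>{0..t} - {T}. Z g \<omega> s)"
  by (simp add: opt_control_def Z_def)

lemma Z_nonneg: "0 \<le> Z g \<omega> s"
  by (simp add: Z_def)

lemma Z_le_\<xi>: "0 \<le> s \<Longrightarrow> s \<le> t \<Longrightarrow> s < T \<Longrightarrow> Z g \<omega> s \<le> \<xi> g t \<omega>"
  unfolding \<xi>_eq by (rule SUP_upper) auto

lemma \<xi>_mono: "t \<le> t' \<Longrightarrow> \<xi> g t \<omega> \<le> \<xi> g t' \<omega>"
  unfolding \<xi>_eq by (rule SUP_subset_mono) auto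

lemma \<xi>_nonneg:
  assumes "t \<in> {0..T}"
  shows "0 \<le> \<xi> g t \<omega>"
  using Z_nonneg[of g \<omega> 0] Z_le_\<xi>[of 0 t g \<omega>] assms T_pos by auto

lemma boundary_le: "K \<le> v g t y \<Longrightarrow> b g t \<le> ereal y"
  unfolding free_boundary_def by (rule Inf_lower) auto

text \<open>The set whose infimum is the boundary is upward closed, by \<open>value_shift\<close>
  with an unchanged profile and e = 0.\<close>

lemma boundary_lessD:
  assumes g: "profile g" and t: "t \<in> {0..T}" and less: "b g t < ereal y"
  shows "K \<le> v g t y"
proof -
  obtain z where "z < y" "K \<le> v g t z"
    using less by (auto simp: free_boundary_def Inf_less_iff)
  then show ?thesis by (intro value_shift[OF g g t, of z 0 y]) auto
qed

lemma le_boundary: "profile g \<Longrightarrow> t \<in> {0..T} \<Longrightarrow> v g t y < K \<Longrightarrow> ereal y \<le> b g t"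
  using boundary_lessD[of g t y] by force

lemma boundary_shift:
  assumes g: "profile g" "profile g'" and t: "t \<in> {0..T}"
    and le: "\<And>s. s \<in> {0..T} \<Longrightarrow> c * (g' s - g s) \<le> e"
  shows "b g' t \<le> b g t + ereal e"
proof (rule dense_ge)
  fix z assume "b g t + ereal e < z"
  then obtain w where w: "b g t + ereal e < ereal w" "ereal w < z" using ereal_dense2 by blast
  then have "b g t < ereal (w - e)" by (cases "b g t") auto
  then have "K \<le> v g t (w - e)" by (rule boundary_lessD[OF g(1) t])
  then have "K \<le> v g' t w" by (rule value_shift[OF g t _ le]) auto
  then show "b g' t \<le> z" using boundary_le[of g' t w] w(2) by (meson order_trans less_imp_le)
qed

lemma \<xi>_shift:
  assumes g: "profile g" "profile g'" and t: "t \<le> T" and e: "0 \<le> e"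
    and le: "\<And>s. s \<in> {0..T} \<Longrightarrow> c * (g' s - g s) \<le> e"
  shows "\<xi> g t \<omega> \<le> \<xi> g' t \<omega> + ereal e"
proof -
  have "Z g \<omega> s \<le> \<xi> g' t \<omega> + ereal e" if s: "s \<in> {0..t} - {T}" for s
  proof -
    have "b g' s \<le> b g s + ereal e" using s t by (intro boundary_shift g le) auto
    then have "Z g \<omega> s \<le> Z g' \<omega> s + ereal e"
      using e by (cases "b g s"; cases "b g' s") (auto simp: Z_def max_def)
    also have "\<dots> \<le> \<xi> g' t \<omega> + ereal e" using s t by (intro add_right_mono Z_le_\<xi>) auto
    finally show ?thesis .
  qed
  then show ?thesis unfolding \<xi>_eq[of g] by (rule SUP_least)
qed

lemma path_tendsto:
  assumes "path_ok \<omega>" "sn \<longlonglongrightarrow> s" "\<And>n. sn n \<in> {0..T}" "s \<in> {0..T}"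
  shows "(\<lambda>n. W (sn n) \<omega>) \<longlonglongrightarrow> W s \<omega>"
  using assms continuous_on_tendsto_compose[of "{0..T}" "\<lambda>t. W t \<omega>" sn s sequentially]
  unfolding path_ok_def by simp

text \<open>A level y slightly below the boundary at s stays below the boundaries of
  \<open>gs n\<close> at \<open>sn n\<close> by \<open>value_less_eventually\<close>, while the path
  moves continuously.\<close>

lemma Z_upper:
  assumes ok: "path_ok \<omega>" and g: "profile g" "\<And>n. profile (gs n)" and lim: "weak_lim gs g"
    and sn: "sn \<longlonglongrightarrow> s" "\<And>n. 0 \<le> sn n \<and> sn n < T" and s: "0 \<le> s" "s < T"
    and less: "Z g \<omega> s < ereal a"
  shows "\<forall>\<^sub>F n in sequentially. Z (gs n) \<omega> (sn n) < ereal a"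
proof -
  \<comment> \<open>Since a > 0, the maximum with 0 in \<open>Z\<close> cannot spoil the strict
    bound.\<close>
  have a: "0 < a" using less Z_nonneg[of g \<omega> s] by (metis ereal_less(2) order_le_less_trans)
  have "ereal (x + \<sigma> * W s \<omega> - a) < b g s"
    using less by (cases "b g s") (auto simp: Z_def)
  then obtain y where y: "x + \<sigma> * W s \<omega> - a < y" "ereal y < b g s"
    using ereal_dense2[of "ereal (x + \<sigma> * W s \<omega> - a)" "b g s"] by auto
  have "v g s y < K"
    using y(2) boundary_le[of g s y] by (meson leD not_le)
  then have 1: "\<forall>\<^sub>F n in sequentially. v (gs n) (sn n) y < K"
    by (rule value_less_eventually[OF g lim sn s])
  have "(\<lambda>n. x + \<sigma> * W (sn n) \<omega> - a) \<longlonglongrightarrow> x + \<sigma> * W s \<omega> - a"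
    using sn s by (intro tendsto_intros path_tendsto[OF ok]) (auto intro: less_imp_le)
  then have 2: "\<forall>\<^sub>F n in sequentially. x + \<sigma> * W (sn n) \<omega> - a < y"
    using y(1) by (rule order_tendstoD)
  from 1 2 show ?thesis
  proof eventually_elim
    case (elim n)
    have "ereal y \<le> b (gs n) (sn n)" using elim(1) sn(2)[of n] by (intro le_boundary g) auto
    then show ?case using elim(2) a by (cases "b (gs n) (sn n)") (auto simp: Z_def)
  qed
qed

text \<open>Compactness: times at which \<open>Z\<close> exceeds a along a subsequence accumulate at
  some l <= t, where \<open>Z_upper\<close> contradicts them. The bound t < T keeps l away from
  T.\<close>

lemma \<xi>_upper:
  assumes ok: "path_ok \<omega>" and g: "profile g" "\<And>n. profile (gs n)" and lim: "weak_lim gs g"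
    and tn: "tn \<longlonglongrightarrow> t" "\<And>n. 0 \<le> tn n \<and> tn n < T" and t: "0 \<le> t" "t < T"
    and less: "\<xi> g t \<omega> < ereal a"
  shows "\<forall>\<^sub>F n in sequentially. \<xi> (gs n) (tn n) \<omega> \<le> ereal a"
proof (rule ccontr)
  assume "\<not> ?thesis"
  then obtain r :: "nat \<Rightarrow> nat" where r: "strict_mono r" "\<And>k. \<not> \<xi> (gs (r k)) (tn (r k)) \<omega> \<le> ereal a"
    using not_eventually_sequentiallyD by blast
  then have "\<exists>s. s \<in> {0..tn (r k)} - {T} \<and> ereal a < Z (gs (r k)) \<omega> s" for k
    using r(2)[of k] unfolding \<xi>_eq not_le less_SUP_iff by blast
  then obtain s where s: "\<And>k. s k \<in> {0..tn (r k)} - {T}" "\<And>k. ereal a < Z (gs (r k)) \<omega> (s k)"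
    by metis
  have sT: "0 \<le> s k \<and> s k < T" for k
    using s(1)[of k] tn(2)[of "r k"] by auto
  then have "\<forall>k. s k \<in> {0..T}" by (auto intro: less_imp_le)
  then obtain l r' where l: "l \<in> {0..T}" and r': "strict_mono (r' :: nat \<Rightarrow> nat)" "(s \<circ> r') \<longlonglongrightarrow> l"
    using compact_imp_seq_compact[OF compact_Icc, of 0 T] unfolding seq_compact_def by blast
  have rr: "strict_mono (r \<circ> r')" using r(1) r'(1) by (rule strict_mono_o)
  have "(\<lambda>k. tn (r (r' k))) \<longlonglongrightarrow> t"
    using LIMSEQ_subseq_LIMSEQ[OF tn(1) rr] by (simp add: comp_def)
  then have lt: "l \<le> t"
    by (rule LIMSEQ_le[OF r'(2)]) (use s(1) in auto)
  have "Z g \<omega> l < ereal a"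
    using Z_le_\<xi>[of l t g \<omega>] l lt t less by auto
  then have "\<forall>\<^sub>F k in sequentially. Z (gs ((r \<circ> r') k)) \<omega> ((s \<circ> r') k) < ereal a"
    using l lt t sT by (intro Z_upper[OF ok g(1) g(2) weak_lim_subseq[OF lim rr] r'(2)]) auto
  then obtain k where "Z (gs (r (r' k))) \<omega> (s (r' k)) < ereal a"
    by (auto simp: eventually_sequentially)
  then show False using s(2)[of "r' k"] by simp
qed

text \<open>\<open>close\<close> asks for closeness only on a short stretch to the right of t. It is
  met in two situations: at a fixed continuity point of the limit (\<open>Z_lower_isCont\<close>),
  and for a single profile along times decreasing to t (\<open>Z_lower_right\<close>).\<close>

lemma Z_lower:
  assumes ok: "path_ok \<omega>" and g: "profile g" "\<And>n. profile (gs n)" and lim: "weak_lim gs g"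
    and tn: "tn \<longlonglongrightarrow> t" "\<And>n. t \<le> tn n \<and> tn n < T" and t: "0 \<le> t" "t < T"
    and close: "\<And>e. 0 < e \<Longrightarrow>
      \<exists>\<eta>>0. \<forall>\<^sub>F n in sequentially. \<forall>s\<in>{0..\<eta>}. \<bar>gs n (s + tn n) - g (s + t)\<bar> \<le> e"
    and less: "a < Z g \<omega> t"
  shows "\<forall>\<^sub>F n in sequentially. a < Z (gs n) \<omega> (tn n)"
proof (cases "a < 0")
  case True
  then show ?thesis by (intro always_eventually allI less_le_trans[OF _ Z_nonneg])
next
  case False
  then obtain a' where a': "a = ereal a'" "0 \<le> a'" using less by (cases a) auto
  have "b g t < ereal (x + \<sigma> * W t \<omega> - a')"
    using less a' by (cases "b g t") (auto simp: Z_def less_max_iff_disj)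
  then obtain y0 where y0: "b g t < ereal y0" "y0 < x + \<sigma> * W t \<omega> - a'"
    using ereal_dense2[of "b g t" "ereal (x + \<sigma> * W t \<omega> - a')"] by auto
  \<comment> \<open>The gap from y0 to y is the raise spent in \<open>value_ge_eventually\<close>;
    the gap above y absorbs the movement of the path.\<close>
  then obtain y where y: "y0 < y" "y < x + \<sigma> * W t \<omega> - a'" using dense by blast
  have K: "K \<le> v g t y0" using y0(1) t by (intro boundary_lessD[OF g(1)]) auto
  \<comment> \<open>Chosen so that |c| e is at most half the raise; the summand 1 covers
    \<open>c\<close> = 0.\<close>
  define e where "e = (y - y0) / (2 * (\<bar>c\<bar> + 1))"
  have e: "0 < e" using y by (simp add: e_def add_pos_pos)
  have ce: "\<bar>c\<bar> * e \<le> (y - y0) / 2"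
  proof -
    have "\<bar>c\<bar> * e \<le> (\<bar>c\<bar> + 1) * e" using e by simp
    also have "\<dots> = (y - y0) / 2"
    proof -
      have "\<bar>c\<bar> + 1 \<noteq> 0" using abs_ge_zero[of c] by linarith
      then show ?thesis unfolding e_def by (simp add: divide_simps)
    qed
    finally show ?thesis .
  qed
  obtain \<eta> where \<eta>: "0 < \<eta>" and c\<eta>: "\<forall>\<^sub>F n in sequentially. \<forall>s\<in>{0..\<eta>}. \<bar>gs n (s + tn n) - g (s + t)\<bar> \<le> e"
    using close[OF e] by blast
  from c\<eta> have "\<forall>\<^sub>F n in sequentially. \<forall>s\<in>{0..\<eta>}. \<bar>c\<bar> * \<bar>gs n (s + tn n) - g (s + t)\<bar> \<le> (y - y0) / 2"
    by eventually_elim (use ce in \<open>meson abs_ge_zero mult_left_mono order_trans\<close>)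
  then have "\<forall>\<^sub>F n in sequentially. K \<le> v (gs n) (tn n) (y0 + (y - y0))"
    using y by (intro value_ge_eventually[OF g lim tn t \<eta> _ _ K]) auto
  moreover have "(\<lambda>n. x + \<sigma> * W (tn n) \<omega> - a') \<longlonglongrightarrow> x + \<sigma> * W t \<omega> - a'"
    using tn t by (intro tendsto_intros path_tendsto[OF ok]) (auto intro: less_imp_le order_trans)
  then have "\<forall>\<^sub>F n in sequentially. y < x + \<sigma> * W (tn n) \<omega> - a'"
    using y(2) by (rule order_tendstoD)
  ultimately show ?thesis
  proof eventually_elim
    case (elim n)
    have "b (gs n) (tn n) \<le> ereal y" using elim(1) boundary_le by simp
    then show ?case using elim(2) a' by (cases "b (gs n) (tn n)") (auto simp: Z_def less_max_iff_disj)
  qed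
qed

text \<open>Between t and a nearby continuity point u > t, both monotone functions are trapped
  between their values at the two ends, so convergence at these two points is uniform closeness in
  between.\<close>

lemma Z_lower_isCont:
  assumes ok: "path_ok \<omega>" and g: "profile g" "\<And>n. profile (gs n)" and lim: "weak_lim gs g"
    and t: "0 \<le> t" "t < T" and cont: "isCont g t" and less: "a < Z g \<omega> t"
  shows "\<forall>\<^sub>F n in sequentially. a < Z (gs n) \<omega> t"
proof (rule Z_lower[OF ok g lim tendsto_const _ t _ less])
  fix e :: real assume e: "0 < e"
  have "eventually (\<lambda>u. g t - e / 3 < g u) (at t)"
    using cont e by (auto simp: isCont_def dest!: order_tendstoD(1)[where a = "g t - e / 3"])
  then obtain d where d: "0 < d" "\<And>u. u \<noteq> t \<Longrightarrow> dist u t < d \<Longrightarrow> g t - e / 3 < g u"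
    by (auto simp: eventually_at)
  obtain u where u: "t < u" "u < t + d" "isCont g u"
    using antimono_isCont_between[OF profile_antimono[OF g(1)], of t "t + d"] d by auto
  have gu: "g t - e / 3 < g u" using d(2)[of u] u by (auto simp: dist_real_def)
  have "(\<lambda>n. gs n u) \<longlonglongrightarrow> g u" "(\<lambda>n. gs n t) \<longlonglongrightarrow> g t"
    using lim u cont by (auto simp: weak_lim_def)
  from order_tendstoD(1)[OF this(1), of "g u - e / 3"] order_tendstoD(2)[OF this(2), of "g t + e / 3"]
  have "\<forall>\<^sub>F n in sequentially. g u - e / 3 < gs n u" "\<forall>\<^sub>F n in sequentially. gs n t < g t + e / 3"
    using e by auto
  then have "\<forall>\<^sub>F n in sequentially. \<forall>s\<in>{0..u - t}. \<bar>gs n (s + t) - g (s + t)\<bar> \<le> e"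
  proof eventually_elim
    case (elim n)
    show ?case
    proof
      fix s assume "s \<in> {0..u - t}"
      then have "gs n u \<le> gs n (s + t)" "gs n (s + t) \<le> gs n t" "g u \<le> g (s + t)" "g (s + t) \<le> g t"
        using antimonoD[OF profile_antimono[OF g(1)]] antimonoD[OF profile_antimono[OF g(2)], of _ _ n] by auto
      then show "\<bar>gs n (s + t) - g (s + t)\<bar> \<le> e" using elim gu e by linarith
    qed
  qed
  then show "\<exists>\<eta>>0. \<forall>\<^sub>F n in sequentially. \<forall>s\<in>{0..\<eta>}. \<bar>gs n (s + t) - g (s + t)\<bar> \<le> e"
    using u by (intro exI[of _ "u - t"]) auto
qed (use t in auto)

lemma Z_lower_right:
  assumes ok: "path_ok \<omega>" and g: "profile g" and t: "0 \<le> t" "t < T" and less: "a < Z g \<omega> t"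
  shows "\<forall>\<^sub>F s in at_right t. a < Z g \<omega> s"
proof (rule sequentially_imp_eventually_at_right[OF t(2)])
  fix tn :: "nat \<Rightarrow> real" assume tn: "\<And>n. t < tn n" "\<And>n. tn n < T" "tn \<longlonglongrightarrow> t"
  show "\<forall>\<^sub>F n in sequentially. a < Z g \<omega> (tn n)"
  proof (rule Z_lower[OF ok g g weak_lim_const tn(3) _ t _ less])
    show "t \<le> tn n \<and> tn n < T" for n using tn(1,2)[of n] by auto
    fix e :: real assume e: "0 < e"
    have "(g \<longlongrightarrow> g t) (at_right t)" using g by (simp add: profile_def continuous_within)
    then have "eventually (\<lambda>u. g t - e < g u) (at_right t)"
      using e by (intro order_tendstoD(1)) auto
    then obtain d where d: "t < d" "\<And>u. t < u \<Longrightarrow> u < d \<Longrightarrow> g t - e < g u"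
      unfolding eventually_at_right_field by blast
    \<comment> \<open>A third each for s and for \<open>tn n\<close> - t, so that s +
      \<open>tn n\<close> stays below d.\<close>
    define \<eta> where "\<eta> = (d - t) / 3"
    have \<eta>: "0 < \<eta>" using d by (simp add: \<eta>_def)
    have "\<forall>\<^sub>F n in sequentially. tn n < t + \<eta>" using tn(3) \<eta> by (intro order_tendstoD) auto
    then have "\<forall>\<^sub>F n in sequentially. \<forall>s\<in>{0..\<eta>}. \<bar>g (s + tn n) - g (s + t)\<bar> \<le> e"
    proof eventually_elim
      case (elim n)
      show ?case
      proof
        fix s assume s: "s \<in> {0..\<eta>}"
        have "s + tn n < d" using s elim \<eta> unfolding \<eta>_def by (auto simp: field_simps)
        then have "g t - e < g (s + tn n)" using s tn(1)[of n] by (intro d(2)) auto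
        moreover have "g (s + tn n) \<le> g (s + t)" "g (s + t) \<le> g t"
          using s tn(1)[of n] by (auto intro!: antimonoD[OF profile_antimono[OF g]])
        ultimately show "\<bar>g (s + tn n) - g (s + t)\<bar> \<le> e" by linarith
      qed
    qed
    then show "\<exists>\<eta>>0. \<forall>\<^sub>F n in sequentially. \<forall>s\<in>{0..\<eta>}. \<bar>g (s + tn n) - g (s + t)\<bar> \<le> e"
      using \<eta> by blast
  qed
qed

text \<open>A time s at which \<open>Z\<close> exceeds a may be a jump of g. If s < t,
  \<open>Z_lower_right\<close> moves it slightly to the right onto a continuity point; s = t leaves
  no room inside [0,t], hence the assumption of continuity at t.\<close>

lemma \<xi>_lower:
  assumes ok: "path_ok \<omega>" and g: "profile g" "\<And>n. profile (gs n)" and lim: "weak_lim gs g"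
    and t: "0 \<le> t" "t < T" and cont: "isCont g t" and less: "a < \<xi> g t \<omega>"
  shows "\<forall>\<^sub>F n in sequentially. a < \<xi> (gs n) t \<omega>"
proof -
  obtain s where s: "s \<in> {0..t} - {T}" "a < Z g \<omega> s"
    using less unfolding \<xi>_eq less_SUP_iff by blast
  obtain u where u: "0 \<le> u" "u \<le> t" "isCont g u" "a < Z g \<omega> u"
  proof (cases "s = t")
    case True
    then show ?thesis using that[of t] s cont t by auto
  next
    case False
    then have "s < t" using s by auto
    have "\<forall>\<^sub>F u in at_right s. a < Z g \<omega> u"
      using s t by (intro Z_lower_right[OF ok g(1)]) auto
    then obtain d where d: "s < d" "\<And>u. s < u \<Longrightarrow> u < d \<Longrightarrow> a < Z g \<omega> u"
      unfolding eventually_at_right_field by blast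
    obtain u where "s < u" "u < min d t" "isCont g u"
      using antimono_isCont_between[OF profile_antimono[OF g(1)], of s "min d t"] d \<open>s < t\<close> by auto
    then show ?thesis using that[of u] d s by auto
  qed
  have "\<forall>\<^sub>F n in sequentially. a < Z (gs n) \<omega> u"
    using u t by (intro Z_lower_isCont[OF ok g lim]) auto
  then show ?thesis
    by eventually_elim (use Z_le_\<xi>[of u t] u t in \<open>auto intro: less_le_trans\<close>)
qed

lemma \<xi>_tendsto:
  assumes ok: "path_ok \<omega>" and g: "profile g" "\<And>n. profile (gs n)" and lim: "weak_lim gs g"
    and t: "0 \<le> t" "t < T" and cont: "isCont g t"
  shows "(\<lambda>n. \<xi> (gs n) t \<omega>) \<longlonglongrightarrow> \<xi> g t \<omega>"
proof (rule order_tendstoI)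
  show "\<forall>\<^sub>F n in sequentially. a < \<xi> (gs n) t \<omega>" if "a < \<xi> g t \<omega>" for a
    by (rule \<xi>_lower[OF ok g lim t cont that])
  fix a assume "\<xi> g t \<omega> < a"
  then obtain a' where a': "\<xi> g t \<omega> < ereal a'" "ereal a' < a" using ereal_dense2 by blast
  have "\<forall>\<^sub>F n in sequentially. \<xi> (gs n) t \<omega> \<le> ereal a'"
    using t by (intro \<xi>_upper[OF ok g lim tendsto_const _ t a'(1)]) auto
  then show "\<forall>\<^sub>F n in sequentially. \<xi> (gs n) t \<omega> < a"
    by eventually_elim (use a' in \<open>auto intro: le_less_trans\<close>)
qed

text \<open>One half is monotonicity of the control in time, the other is \<open>\<xi>_upper\<close>
  for a constant sequence of profiles.\<close>

lemma \<xi>_right: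
  assumes ok: "path_ok \<omega>" and g: "profile g" and t: "0 \<le> t" "t < T"
    and tn: "tn \<longlonglongrightarrow> t" "\<And>n. t \<le> tn n \<and> tn n < T"
  shows "(\<lambda>n. \<xi> g (tn n) \<omega>) \<longlonglongrightarrow> \<xi> g t \<omega>"
proof (rule order_tendstoI)
  show "\<forall>\<^sub>F n in sequentially. a < \<xi> g (tn n) \<omega>" if "a < \<xi> g t \<omega>" for a
    using that \<xi>_mono tn(2) by (meson always_eventually less_le_trans)
  fix a assume "\<xi> g t \<omega> < a"
  then obtain a' where a': "\<xi> g t \<omega> < ereal a'" "ereal a' < a" using ereal_dense2 by blast
  have "0 \<le> tn n \<and> tn n < T" for n using tn(2)[of n] t by auto
  then have "\<forall>\<^sub>F n in sequentially. \<xi> g (tn n) \<omega> \<le> ereal a'"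
    by (rule \<xi>_upper[OF ok g g weak_lim_const tn(1) _ t a'(1)])
  then show "\<forall>\<^sub>F n in sequentially. \<xi> g (tn n) \<omega> < a"
    by eventually_elim (use a' in \<open>auto intro: le_less_trans\<close>)
qed

text \<open>By \<open>Z_lower_right\<close> every lower bound on \<open>Z\<close> persists at
  rational times just to the right, so a countable supremum suffices almost surely. The end point t
  is kept because it has no right neighbours in [0,t].\<close>

lemma \<xi>_measurable:
  assumes g: "profile g" and t: "t \<in> {0..T}"
  shows "(\<lambda>\<omega>. \<xi> g t \<omega>) \<in> borel_measurable M"
proof (rule borel_measurable_AE_eq)
  let ?Q = "{s \<in> {0..t} - {T}. s \<in> \<rat> \<or> s = t}"
  show "(\<lambda>\<omega>. SUP s\<in>?Q. Z g \<omega> s) \<in> borel_measurable M"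
  proof (rule borel_measurable_SUP)
    have "countable (\<rat> \<union> {t})" using countable_rat by simp
    then show "countable ?Q" by (rule countable_subset[rotated]) auto
    fix s assume "s \<in> ?Q"
    then have [measurable]: "W s \<in> borel_measurable M" using t by (intro W_measurable) auto
    show "(\<lambda>\<omega>. Z g \<omega> s) \<in> borel_measurable M" unfolding Z_def by measurable
  qed
  show "AE \<omega> in M. \<xi> g t \<omega> = (SUP s\<in>?Q. Z g \<omega> s)"
    using AE_path_ok
  proof eventually_elim
    case (elim \<omega>)
    show ?case unfolding \<xi>_eq
    proof (rule antisym)
      show "(SUP s\<in>?Q. Z g \<omega> s) \<le> (SUP s\<in>{0..t} - {T}. Z g \<omega> s)" by (rule SUP_subset_mono) auto
      show "(SUP s\<in>{0..t} - {T}. Z g \<omega> s) \<le> (SUP s\<in>?Q. Z g \<omega> s)"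
      proof (intro SUP_least)
        fix s assume s: "s \<in> {0..t} - {T}"
        show "Z g \<omega> s \<le> (SUP s\<in>?Q. Z g \<omega> s)"
        proof (cases "s = t")
          case True
          with s show ?thesis by (intro SUP_upper) auto
        next
          case False
          show ?thesis
          proof (rule dense_le)
            fix a assume "a < Z g \<omega> s"
            then have "\<forall>\<^sub>F u in at_right s. a < Z g \<omega> u"
              using s t by (intro Z_lower_right[OF elim g]) auto
            then obtain d where d: "s < d" "\<And>u. s < u \<Longrightarrow> u < d \<Longrightarrow> a < Z g \<omega> u"
              unfolding eventually_at_right_field by blast
            have "s < min d t" using d s False by auto
            then obtain u where u: "u \<in> \<rat>" "s < u" "u < min d t" using Rats_dense_in_real by blast
            then have "Z g \<omega> u \<le> (SUP s\<in>?Q. Z g \<omega> s)" using s t by (intro SUP_upper) auto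
            then show "a \<le> (SUP s\<in>?Q. Z g \<omega> s)" using d(2)[of u] u by auto
          qed
        qed
      qed
    qed
  qed
qed

end

section \<open>The map \<open>\<Psi>\<close> on profiles\<close>

locale fixed_point_problem = control_problem +
  assumes large: "sufficiently_large M F W T \<sigma> \<rho> K \<alpha> x \<delta>"
begin

lemma value_cong:
  assumes eq: "\<And>s. s \<in> {0..T} \<Longrightarrow> g s = h s" and t: "t \<in> {0..T}"
  shows "v g t y = v h t y"
  unfolding value_fun_def
proof (intro INF_cong refl Bochner_Integration.integral_cong)
  fix \<tau> \<omega> assume \<tau>: "\<tau> \<in> ST t" and \<omega>: "\<omega> \<in> space M"
  have "g (s + t) = h (s + t)" if "s \<in> {0..\<tau> \<omega>}" for s
    using that ST_range[OF \<tau> \<omega>] t by (intro eq) auto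
  then show "(LBINT s:{0..\<tau> \<omega>}. exp (- \<rho> * s) * (y + \<sigma> * W s \<omega> - \<alpha> * (2 - \<alpha>) * g (s + t))) + K * exp (- \<rho> * \<tau> \<omega>)
    = (LBINT s:{0..\<tau> \<omega>}. exp (- \<rho> * s) * (y + \<sigma> * W s \<omega> - \<alpha> * (2 - \<alpha>) * h (s + t))) + K * exp (- \<rho> * \<tau> \<omega>)"
    by (intro arg_cong2[where f = "(+)"] refl set_lebesgue_integral_cong) auto
qed

lemma \<xi>_cong_boundary: "(\<And>s. s \<in> {0..t} - {T} \<Longrightarrow> b g s = b h s) \<Longrightarrow> \<xi> g t \<omega> = \<xi> h t \<omega>"
  unfolding opt_control_def by (rule SUP_cong) auto

lemma \<xi>_cong:
  assumes "\<And>s. s \<in> {0..T} \<Longrightarrow> g s = h s" "t \<le> T"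
  shows "\<xi> g t \<omega> = \<xi> h t \<omega>"
  by (rule \<xi>_cong_boundary) (use assms value_cong[of g h] in \<open>auto simp: free_boundary_def\<close>)

text \<open>The value function sees a profile only through integrals in time, so the value of the profile
  at \<open>T\<close> is irrelevant.\<close>

lemma \<xi>_cong_less:
  assumes g: "profile g" "profile h" and eq: "\<And>s. s \<in> {0..<T} \<Longrightarrow> g s = h s" and t: "t \<le> T"
  shows "\<xi> g t \<omega> = \<xi> h t \<omega>"
proof (rule \<xi>_cong_boundary)
  fix u assume u: "u \<in> {0..t} - {T}"
  have G: "G u y g r = G u y h r" if "r \<le> T - u" for r y
    unfolding G_def
  proof (rule set_lebesgue_integral_cong_AE)
    note [measurable] = profile_measurable[OF g(1)] profile_measurable[OF g(2)]
    show "(\<lambda>s. exp (- \<rho> * s) * (y - c * g (s + u))) \<in> borel_measurable lborel"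
      "(\<lambda>s. exp (- \<rho> * s) * (y - c * h (s + u))) \<in> borel_measurable lborel" by measurable
    \<comment> \<open>For r <= T - u the time s + u reaches T at the single point s = T - u at
      most.\<close>
    show "AE s\<in>{0..r} in lborel. exp (- \<rho> * s) * (y - c * g (s + u)) = exp (- \<rho> * s) * (y - c * h (s + u))"
      using AE_lborel_singleton[of "T - u"] by eventually_elim (use u that eq in auto)
  qed auto
  have "K \<le> v g u y \<longleftrightarrow> K \<le> v h u y" for y
    using value_comparison[OF g _ order_refl, of u y y] value_comparison[OF g(2,1) _ order_refl, of u y y] G u t
    by auto
  then show "b g u = b h u" by (simp add: free_boundary_def)
qed

text \<open>The profile with the largest control: the control decreases in \<open>c\<close> g, so
  the sign of \<open>c\<close> selects the end of [x - \<delta>, x]. Both candidates occur in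
  \<open>sufficiently_large\<close>.\<close>

definition extremal :: "real \<Rightarrow> real" where
  "extremal = (\<lambda>_. if 0 \<le> c then x - \<delta> else x)"

definition S :: "'a \<Rightarrow> real" where "S \<omega> = real_of_ereal (\<xi> extremal T \<omega>)"

lemma profile_extremal: "profile extremal"
  using \<delta>_pos by (auto simp: profile_def extremal_def antimono_def)

lemma \<xi>_le_extremal:
  assumes g: "profile g" and t: "t \<le> T"
  shows "\<xi> g t \<omega> \<le> \<xi> extremal T \<omega>"
proof -
  have "\<xi> g t \<omega> \<le> \<xi> extremal t \<omega> + ereal 0"
  proof (rule \<xi>_shift[OF g profile_extremal t order_refl])
    fix s
    have "x - \<delta> \<le> g s" "g s \<le> x" using g by (auto simp: profile_def)
    then show "c * (extremal s - g s) \<le> 0"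
      by (auto simp: extremal_def mult_nonneg_nonpos mult_nonpos_nonneg)
  qed
  also have "\<dots> \<le> \<xi> extremal T \<omega>" using \<xi>_mono[OF t] by simp
  finally show ?thesis .
qed

text \<open>The hypothesis on \<delta> bounds a nonnegative integral, which also forces finiteness
  almost surely. \<open>S\<close> thereby becomes an integrable majorant of every control.\<close>

lemma S_integrable: "AE \<omega> in M. \<xi> extremal T \<omega> = ereal (S \<omega>)" "integrable M S" "expectation S \<le> \<delta>"
proof -
  have eq: "control_mean M F W T \<sigma> \<rho> K \<alpha> x (\<lambda>t\<in>{0..T}. k) = control_mean M F W T \<sigma> \<rho> K \<alpha> x (\<lambda>_. k)" for k
    unfolding control_mean_def by (intro nn_integral_cong arg_cong[where f = e2ennreal] \<xi>_cong) auto
  have le: "(\<integral>\<^sup>+ \<omega>. e2ennreal (\<xi> extremal T \<omega>) \<partial>M) \<le> ennreal \<delta>"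
    using large unfolding sufficiently_large_def eq by (auto simp: extremal_def control_mean_def)
  have [measurable]: "(\<lambda>\<omega>. \<xi> extremal T \<omega>) \<in> borel_measurable M"
    using T_pos by (intro \<xi>_measurable profile_extremal) auto
  have nn: "0 \<le> \<xi> extremal T \<omega>" for \<omega> using T_pos by (intro \<xi>_nonneg) auto
  have "AE \<omega> in M. e2ennreal (\<xi> extremal T \<omega>) \<noteq> \<infinity>"
    by (rule nn_integral_PInf_AE) (use le in \<open>auto simp: top_unique\<close>)
  then show AE: "AE \<omega> in M. \<xi> extremal T \<omega> = ereal (S \<omega>)"
  proof eventually_elim
    case (elim \<omega>)
    then have "\<xi> extremal T \<omega> \<noteq> \<infinity>" by auto
    then show ?case using nn[of \<omega>] unfolding S_def by (cases "\<xi> extremal T \<omega>") auto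
  qed
  have [measurable]: "S \<in> borel_measurable M" unfolding S_def by measurable
  have Snn: "0 \<le> S \<omega>" for \<omega> using nn[of \<omega>] by (simp add: S_def real_of_ereal_pos)
  have "(\<integral>\<^sup>+ \<omega>. ennreal (S \<omega>) \<partial>M) = (\<integral>\<^sup>+ \<omega>. e2ennreal (\<xi> extremal T \<omega>) \<partial>M)"
    by (rule nn_integral_cong_AE) (use AE in \<open>auto elim!: eventually_mono simp: e2ennreal_ereal\<close>)
  with le have le': "(\<integral>\<^sup>+ \<omega>. ennreal (S \<omega>) \<partial>M) \<le> ennreal \<delta>" by simp
  show int: "integrable M S"
    by (rule integrableI_nonneg) (use Snn le' in \<open>auto intro: le_less_trans\<close>)
  have "ennreal (expectation S) \<le> ennreal \<delta>"
    using le' nn_integral_eq_integral[OF int] Snn by simp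
  then show "expectation S \<le> \<delta>" using \<delta>_pos by (simp add: ennreal_le_iff)
qed

definition X :: "(real \<Rightarrow> real) \<Rightarrow> real \<Rightarrow> 'a \<Rightarrow> real" where "X g t \<omega> = real_of_ereal (\<xi> g t \<omega>)"

lemma X_bounds:
  assumes g: "profile g" and t: "t \<in> {0..T}"
  shows "X g t \<in> borel_measurable M" "AE \<omega> in M. \<xi> g t \<omega> = ereal (X g t \<omega>)"
    "AE \<omega> in M. norm (X g t \<omega>) \<le> S \<omega>" "integrable M (X g t)"
    "0 \<le> expectation (X g t)" "expectation (X g t) \<le> \<delta>"
proof -
  have [measurable]: "(\<lambda>\<omega>. \<xi> g t \<omega>) \<in> borel_measurable M" by (rule \<xi>_measurable[OF g t])
  show m: "X g t \<in> borel_measurable M" unfolding X_def by measurable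
  have both: "AE \<omega> in M. \<xi> g t \<omega> = ereal (X g t \<omega>) \<and> norm (X g t \<omega>) \<le> S \<omega>"
    using S_integrable(1)
  proof eventually_elim
    case (elim \<omega>)
    then show ?case
      using \<xi>_nonneg[OF t, of g \<omega>] \<xi>_le_extremal[OF g, of t \<omega>] t unfolding X_def
      by (cases "\<xi> g t \<omega>") auto
  qed
  then show "AE \<omega> in M. \<xi> g t \<omega> = ereal (X g t \<omega>)" and n: "AE \<omega> in M. norm (X g t \<omega>) \<le> S \<omega>"
    by auto
  have nn: "0 \<le> X g t \<omega>" for \<omega> using \<xi>_nonneg[OF t, of g \<omega>] by (simp add: X_def real_of_ereal_pos)
  show int: "integrable M (X g t)"
    by (rule Bochner_Integration.integrable_bound[OF S_integrable(2) m]) (use n in \<open>auto elim!: eventually_mono\<close>)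
  show "0 \<le> expectation (X g t)" using nn by simp
  have "expectation (X g t) \<le> expectation S"
    by (rule integral_mono_AE[OF int S_integrable(2)]) (use n in \<open>auto elim!: eventually_mono\<close>)
  then show "expectation (X g t) \<le> \<delta>" using S_integrable(3) by simp
qed

lemma expectation_X_tendsto:
  assumes g: "profile g" "\<And>n. profile (gs n)" and t: "t \<in> {0..T}" "\<And>n. tn n \<in> {0..T}"
    and lim: "\<And>\<omega>. path_ok \<omega> \<Longrightarrow> (\<lambda>n. \<xi> (gs n) (tn n) \<omega>) \<longlonglongrightarrow> \<xi> g t \<omega>"
  shows "(\<lambda>n. expectation (X (gs n) (tn n))) \<longlonglongrightarrow> expectation (X g t)"
proof (rule integral_dominated_convergence[OF _ _ S_integrable(2)])
  show "X g t \<in> borel_measurable M" "\<And>n. X (gs n) (tn n) \<in> borel_measurable M"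
    "\<And>n. AE \<omega> in M. norm (X (gs n) (tn n) \<omega>) \<le> S \<omega>"
    using X_bounds g t by auto
  show "AE \<omega> in M. (\<lambda>n. X (gs n) (tn n) \<omega>) \<longlonglongrightarrow> X g t \<omega>"
    using AE_path_ok X_bounds(2)[OF g(1) t(1)]
  proof eventually_elim
    case (elim \<omega>)
    then show ?case unfolding X_def[of "gs _"] using lim[OF elim(1)] lim_real_of_ereal[of _ "X g t \<omega>"] by simp
  qed
qed

text \<open>Psi acting on profiles (see \<open>Psi_eq\<close>): the Brownian term has mean 0, and
  clamping the time makes the image a function on the line again.\<close>

definition m :: "(real \<Rightarrow> real) \<Rightarrow> real \<Rightarrow> real" where
  "m g t = x - expectation (X g (max 0 (min T t)))"

lemma m_eq: "t \<in> {0..T} \<Longrightarrow> m g t = x - expectation (X g t)"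
  by (simp add: m_def)

lemma m_right:
  assumes g: "profile g" and t: "0 \<le> t" "t < T" and tn: "tn \<longlonglongrightarrow> t" "\<And>n. t \<le> tn n \<and> tn n < T"
  shows "(\<lambda>n. m g (tn n)) \<longlonglongrightarrow> m g t"
proof -
  have "tn n \<in> {0..T}" for n using t tn(2)[of n] by auto
  moreover have "(\<lambda>n. expectation (X g (tn n))) \<longlonglongrightarrow> expectation (X g t)"
    using t calculation by (intro expectation_X_tendsto g \<xi>_right[OF _ g t tn]) auto
  ultimately show ?thesis using t by (simp add: m_eq tendsto_intros)
qed

lemma m_tendsto:
  assumes g: "profile g" "\<And>n. profile (gs n)" and lim: "weak_lim gs g"
    and t: "0 \<le> t" "t < T" and cont: "isCont g t"
  shows "(\<lambda>n. m (gs n) t) \<longlonglongrightarrow> m g t"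
proof -
  have "(\<lambda>n. expectation (X (gs n) t)) \<longlonglongrightarrow> expectation (X g t)"
    using t by (intro expectation_X_tendsto g \<xi>_tendsto[OF _ g lim t cont]) auto
  then show ?thesis using t by (simp add: m_eq tendsto_intros)
qed

lemma m_antimono:
  assumes g: "profile g"
  shows "antimono (m g)"
proof (rule antimonoI)
  fix s t :: real assume "s \<le> t"
  define s' t' where "s' = max 0 (min T s)" and "t' = max 0 (min T t)"
  have st: "s' \<in> {0..T}" "t' \<in> {0..T}" "s' \<le> t'" using T_pos \<open>s \<le> t\<close> by (auto simp: s'_def t'_def)
  have "expectation (X g s') \<le> expectation (X g t')"
  proof (rule integral_mono_AE)
    show "AE \<omega> in M. X g s' \<omega> \<le> X g t' \<omega>"
      using X_bounds(2)[OF g st(1)] X_bounds(2)[OF g st(2)]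
      by eventually_elim (metis \<xi>_mono[OF st(3)] ereal_less_eq(3))
  qed (use X_bounds(4) g st in auto)
  then show "m g t \<le> m g s" by (simp add: m_def s'_def t'_def)
qed

lemma profile_m:
  assumes g: "profile g"
  shows "profile (m g)"
  unfolding profile_def
proof (intro conjI allI m_antimono g)
  fix s
  have s: "max 0 (min T s) \<in> {0..T}" using T_pos by auto
  show "x - \<delta> \<le> m g s" "m g s \<le> x" using X_bounds(5,6)[OF g s] by (auto simp: m_def)
  show "continuous (at_right s) (m g)"
  proof (cases "0 \<le> s \<and> s < T")
    case True
    show ?thesis unfolding continuous_within
      by (rule tendsto_at_right_sequentially[of s T]) (use True in \<open>auto intro!: m_right[OF g] less_imp_le\<close>)
  next
    case False
    \<comment> \<open>Outside [0,T) the clamped time is constant on (s,u), and so is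
      \<open>m g\<close>.\<close>
    define u where "u = (if s < 0 then 0 else s + 1)"
    have "s < u" by (auto simp: u_def)
    have "eventually (\<lambda>r. m g r = m g s) (at_right s)"
      unfolding eventually_at_right_field
      by (rule exI[of _ u]) (use False T_pos in \<open>auto simp: u_def m_def split: if_splits\<close>)
    then show ?thesis unfolding continuous_within by (rule tendsto_eventually)
  qed
qed

lemma m_lipschitz:
  assumes g: "profile g" "profile h" and le: "\<And>s. s \<in> {0..T} \<Longrightarrow> \<bar>g s - h s\<bar> \<le> e"
  shows "\<bar>m g t - m h t\<bar> \<le> \<bar>c\<bar> * e"
proof -
  define u where "u = max 0 (min T t)"
  have u: "u \<in> {0..T}" using T_pos by (auto simp: u_def)
  have e: "0 \<le> \<bar>c\<bar> * e" using le[of 0] T_pos by simp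
  have one: "expectation (X g u) \<le> expectation (X h u) + \<bar>c\<bar> * e"
    if g: "profile g" "profile h" and le: "\<And>s. s \<in> {0..T} \<Longrightarrow> \<bar>g s - h s\<bar> \<le> e" for g h
  proof -
    have "expectation (X g u) \<le> expectation (\<lambda>\<omega>. X h u \<omega> + \<bar>c\<bar> * e)"
    proof (rule integral_mono_AE)
      have "c * (h s - g s) \<le> \<bar>c\<bar> * e" if "s \<in> {0..T}" for s
      proof -
        have "c * (h s - g s) \<le> \<bar>c\<bar> * \<bar>g s - h s\<bar>" by (metis abs_ge_self abs_minus_commute abs_mult)
        also have "\<dots> \<le> \<bar>c\<bar> * e" using le[OF that] by (rule mult_left_mono) simp
        finally show ?thesis .
      qed
      then have shift: "\<xi> g u \<omega> \<le> \<xi> h u \<omega> + ereal (\<bar>c\<bar> * e)" for \<omega>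
        using u e by (intro \<xi>_shift g) auto
      show "AE \<omega> in M. X g u \<omega> \<le> X h u \<omega> + \<bar>c\<bar> * e"
        using X_bounds(2)[OF g(1) u] X_bounds(2)[OF g(2) u]
        by eventually_elim (metis shift ereal_less_eq(3) plus_ereal.simps(1))
    qed (use X_bounds(4)[OF g(1) u] X_bounds(4)[OF g(2) u] in auto)
    then show ?thesis using X_bounds(4)[OF g(2) u] by (simp add: prob_space)
  qed
  show ?thesis
    using one[OF g le] one[OF g(2,1)] le unfolding m_def u_def by (simp add: abs_le_iff abs_minus_commute)
qed

lemma Psi_eq:
  assumes g: "profile g" and eq: "\<And>s. s \<in> {0..T} \<Longrightarrow> \<theta> s = g s" and t: "t \<in> {0..T}"
  shows "AE \<omega> in M. opt_control M F W T \<sigma> \<rho> K \<alpha> x \<theta> t \<omega> < \<infinity>"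
    "integrable M (opt_state M F W T \<sigma> \<rho> K \<alpha> x \<theta> t)"
    "Psi M F W T \<sigma> \<rho> K \<alpha> x \<theta> t = m g t"
proof -
  have \<xi>: "\<xi> \<theta> t \<omega> = \<xi> g t \<omega>" for \<omega> by (rule \<xi>_cong[OF eq]) (use t in auto)
  show "AE \<omega> in M. \<xi> \<theta> t \<omega> < \<infinity>" unfolding \<xi> using X_bounds(2)[OF g t] by eventually_elim simp
  have state: "opt_state M F W T \<sigma> \<rho> K \<alpha> x \<theta> t = (\<lambda>\<omega>. x + \<sigma> * W t \<omega> - X g t \<omega>)"
    by (simp add: fun_eq_iff opt_state_def \<xi> X_def)
  show "integrable M (opt_state M F W T \<sigma> \<rho> K \<alpha> x \<theta> t)"
    unfolding state using X_bounds(4)[OF g t] W_moments(1)[OF t] by simp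
  show "Psi M F W T \<sigma> \<rho> K \<alpha> x \<theta> t = m g t"
    using t X_bounds(4)[OF g t] W_moments(1,2)[OF t] by (simp add: Psi_def state m_eq prob_space)
qed

section \<open>Approximate fixed points and their limit\<close>

lemma E_set_profile:
  assumes "\<theta> \<in> E_set T x \<delta>"
  obtains g where "profile g" "\<And>s. s \<in> {0..T} \<Longrightarrow> \<theta> s = g s"
proof
  let ?g = "\<lambda>s. \<theta> (max 0 (min T s))"
  have clamp: "max 0 (min T s) \<in> {0..T}" for s using T_pos by auto
  have anti: "antimono_on {0..T} \<theta>" and rc: "\<And>t. t \<in> {0..<T} \<Longrightarrow> (\<theta> \<longlongrightarrow> \<theta> t) (at_right t)"
    and bnd: "\<And>t. t \<in> {0..T} \<Longrightarrow> x - \<delta> \<le> \<theta> t \<and> \<theta> t \<le> x"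
    using assms by (auto simp: E_set_def Theta_def cadlag_on_def)
  show "profile ?g"
    unfolding profile_def
  proof (intro conjI allI)
    show "antimono ?g"
    proof (rule antimonoI)
      fix s t :: real assume "s \<le> t"
      then have "max 0 (min T s) \<le> max 0 (min T t)" by auto
      then show "?g t \<le> ?g s" using anti clamp by (auto simp: monotone_on_def)
    qed
    fix s
    show "x - \<delta> \<le> ?g s" "?g s \<le> x" using bnd[OF clamp] by auto
    show "continuous (at_right s) ?g"
    proof (cases "0 \<le> s \<and> s < T")
      case True
      have "eventually (\<lambda>r. ?g r = \<theta> r) (at_right s)"
        unfolding eventually_at_right_field by (rule exI[of _ T]) (use True in auto)
      moreover have "(\<theta> \<longlongrightarrow> ?g s) (at_right s)" using rc[of s] True by simp
      ultimately show ?thesis unfolding continuous_within by (subst tendsto_cong)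
    next
      case False
      define u where "u = (if s < 0 then 0 else s + 1)"
      have "eventually (\<lambda>r. ?g r = ?g s) (at_right s)"
        unfolding eventually_at_right_field
        by (rule exI[of _ u]) (use False T_pos in \<open>auto simp: u_def split: if_splits\<close>)
      then show ?thesis unfolding continuous_within by (rule tendsto_eventually)
    qed
  qed
qed (use T_pos in auto)

lemma profile_E_set:
  assumes g: "profile g"
  shows "restrict g {0..T} \<in> E_set T x \<delta>"
proof -
  let ?h = "restrict g {0..T}"
  have bnd: "x - \<delta> \<le> g s \<and> g s \<le> x" for s using g by (auto simp: profile_def)
  have anti: "s \<le> t \<Longrightarrow> g t \<le> g s" for s t using antimonoD[OF profile_antimono[OF g]] .
  have "(?h \<longlongrightarrow> ?h t) (at_right t)" if t: "t \<in> {0..<T}" for t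
  proof -
    have "eventually (\<lambda>r. ?h r = g r) (at_right t)"
      unfolding eventually_at_right_field by (rule exI[of _ T]) (use t in auto)
    moreover have "(g \<longlongrightarrow> ?h t) (at_right t)" using g t by (auto simp: profile_def continuous_within)
    ultimately show ?thesis by (subst tendsto_cong)
  qed
  moreover have "\<exists>l. (?h \<longlongrightarrow> l) (at_left t)" if t: "t \<in> {0<..T}" for t
  proof -
    \<comment> \<open>Left limits exist by monotonicity and boundedness; the sign turns g into a
      non-decreasing function.\<close>
    have "((\<lambda>s. - g s) \<longlongrightarrow> (SUP s\<in>{..<t} \<inter> UNIV. - g s)) (at t within ({..<t} \<inter> UNIV))"
    proof (rule Lim_left_bound)
      show "- g s \<le> - (x - \<delta>)" for s using bnd[of s] by linarith
    qed (use anti in simp)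
    then have "(g \<longlongrightarrow> - (SUP s\<in>{..<t}. - g s)) (at_left t)"
      by (auto dest: tendsto_minus)
    moreover have "eventually (\<lambda>r. ?h r = g r) (at_left t)"
      unfolding eventually_at_left_field by (rule exI[of _ 0]) (use t in auto)
    ultimately have "(?h \<longlongrightarrow> - (SUP s\<in>{..<t}. - g s)) (at_left t)" by (subst tendsto_cong)
    then show ?thesis by blast
  qed
  ultimately have "cadlag_on T ?h" by (simp add: cadlag_on_def)
  moreover have "bounded (?h ` {0..T})"
    unfolding bounded_iff using profile_bound[OF g] by auto
  moreover have "antimono_on {0..T} ?h" using anti by (auto simp: monotone_on_def)
  ultimately show ?thesis using bnd by (auto simp: E_set_def Theta_def)
qed

section \<open>Discretisation by step profiles\<close>

text \<open>Cells are closed on the left, which makes \<open>step\<close> right-continuous.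
  \<open>nat\<close> sends negative times to the first cell and the minimum sends times from T on to
  the last.\<close>

definition cell :: "nat \<Rightarrow> real \<Rightarrow> nat" where
  "cell N s = min (N - 1) (nat \<lfloor>s * real N / T\<rfloor>)"

text \<open>The running minimum turns an arbitrary vector of the cube into a non-increasing one, and it
  fixes the vectors that already are.\<close>

definition step :: "nat \<Rightarrow> (nat \<Rightarrow> real) \<Rightarrow> real \<Rightarrow> real" where
  "step N a s = x - \<delta> + \<delta> * Min (a ` {..cell N s})"

lemma cell_less: "0 < N \<Longrightarrow> cell N s < N"
  by (simp add: cell_def)

lemma cell_mono: "s \<le> t \<Longrightarrow> cell N s \<le> cell N t"
  using T_pos unfolding cell_def
  by (intro min.mono order_refl nat_mono floor_mono divide_right_mono mult_right_mono) auto

lemma profile_step: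
  assumes N: "0 < N" and a: "\<And>j. j < N \<Longrightarrow> 0 \<le> a j \<and> a j \<le> 1"
  shows "profile (step N a)"
  unfolding profile_def
proof (intro conjI allI)
  have "Min (a ` {..cell N t}) \<le> Min (a ` {..cell N s})" if "s \<le> t" for s t
    using cell_mono[OF that] by (intro Min_antimono image_mono) auto
  then show "antimono (step N a)" using \<delta>_pos by (auto simp: step_def intro!: antimonoI)
  fix s
  have "Min (a ` {..cell N s}) \<in> a ` {..cell N s}" by (rule Min_in) auto
  then obtain j where j: "j \<le> cell N s" "Min (a ` {..cell N s}) = a j" by blast
  then have "0 \<le> a j" "a j \<le> 1" using a[of j] cell_less[OF N, of s] by auto
  then show "x - \<delta> \<le> step N a s" "step N a s \<le> x"
    using \<delta>_pos by (simp_all add: step_def j(2) mult_left_le)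
  define k where "k = \<lfloor>s * real N / T\<rfloor>"
  have "s * real N / T < real_of_int (k + 1)" unfolding k_def by linarith
  then have s: "s < real_of_int (k + 1) * T / real N" using T_pos N by (simp add: field_simps)
  have "eventually (\<lambda>r. step N a r = step N a s) (at_right s)"
    unfolding eventually_at_right_field
  proof (intro exI[of _ "real_of_int (k + 1) * T / real N"] conjI allI impI s)
    fix r assume r: "s < r" "r < real_of_int (k + 1) * T / real N"
    have "r * real N / T < real_of_int (k + 1)" using r(2) T_pos N by (simp add: field_simps)
    moreover have "s * real N / T \<le> r * real N / T"
      using r(1) T_pos by (intro divide_right_mono mult_right_mono) auto
    then have "real_of_int k \<le> r * real N / T" unfolding k_def by linarith
    ultimately have "\<lfloor>r * real N / T\<rfloor> = k" by (simp add: floor_eq_iff)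
    then show "step N a r = step N a s" by (simp add: step_def cell_def k_def)
  qed
  then show "continuous (at_right s) (step N a)" unfolding continuous_within by (rule tendsto_eventually)
qed

text \<open>A minimum is 1-Lipschitz in the supremum norm, so the constant does not grow with
  N.\<close>

lemma step_lipschitz:
  assumes N: "0 < N" and le: "\<And>j. j < N \<Longrightarrow> \<bar>a j - a' j\<bar> \<le> e"
  shows "\<bar>step N a s - step N a' s\<bar> \<le> \<delta> * e"
proof -
  have one: "Min (a ` {..cell N s}) - e \<le> Min (a' ` {..cell N s})"
    if le: "\<And>j. j < N \<Longrightarrow> \<bar>a j - a' j\<bar> \<le> e" for a a' :: "nat \<Rightarrow> real"
  proof (rule Min.boundedI)
    fix z assume "z \<in> a' ` {..cell N s}"
    then obtain j where j: "j \<le> cell N s" "z = a' j" by auto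
    have "Min (a ` {..cell N s}) \<le> a j" using j by (intro Min_le) auto
    moreover have "\<bar>a j - a' j\<bar> \<le> e" using le[of j] j cell_less[OF N, of s] by auto
    ultimately show "Min (a ` {..cell N s}) - e \<le> z" using j(2) by linarith
  qed auto
  have "\<bar>Min (a ` {..cell N s}) - Min (a' ` {..cell N s})\<bar> \<le> e"
    using one[OF le] one[of a' a] le by (simp add: abs_le_iff abs_minus_commute algebra_simps)
  then have "\<delta> * \<bar>Min (a ` {..cell N s}) - Min (a' ` {..cell N s})\<bar> \<le> \<delta> * e"
    using \<delta>_pos by simp
  moreover have "step N a s - step N a' s = \<delta> * (Min (a ` {..cell N s}) - Min (a' ` {..cell N s}))"
    by (simp add: step_def algebra_simps)
  ultimately show ?thesis using \<delta>_pos by (simp add: abs_mult)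
qed

text \<open>\<open>s'\<close> is the grid node to the left of s: the image is sampled at nodes only,
  so it is matched with a lag of less than one cell.\<close>

lemma approximate_fixed_point:
  assumes N: "0 < N"
  obtains g where "profile g"
    "\<And>s. s \<in> {0..<T} \<Longrightarrow> \<exists>s'. 0 \<le> s' \<and> s' \<le> s \<and> s - T / real N < s' \<and> \<bar>g s - m g s'\<bar> \<le> \<delta> / real N"
proof -
  define node where "node i = real i * T / real N" for i
  \<comment> \<open>The image sampled at the nodes, with [x - \<delta>, x] rescaled to
    [0,1].\<close>
  define H where "H a i = (m (step N a) (node i) - (x - \<delta>)) / \<delta>" for a i
  obtain a where a: "\<And>j. j < N \<Longrightarrow> 0 \<le> a j \<and> a j \<le> 1"
    and fix_a: "\<And>i. i < N \<Longrightarrow> \<bar>H a i - a i\<bar> \<le> 1 / real N"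
  proof (rule approximate_fixed_point_cube[of N H "\<bar>c\<bar>" "1 / real N"])
    show "0 \<le> H a i \<and> H a i \<le> 1" if "\<And>j. j < N \<Longrightarrow> 0 \<le> a j \<and> a j \<le> 1" for a i
    proof -
      have "profile (m (step N a))" by (intro profile_m profile_step N that)
      then have "x - \<delta> \<le> m (step N a) (node i)" "m (step N a) (node i) \<le> x" by (auto simp: profile_def)
      then show ?thesis using \<delta>_pos by (simp add: H_def)
    qed
    show "\<bar>H a i - H a' i\<bar> \<le> \<bar>c\<bar> * e"
      if "\<And>j. j < N \<Longrightarrow> 0 \<le> a j \<and> a j \<le> 1" "\<And>j. j < N \<Longrightarrow> 0 \<le> a' j \<and> a' j \<le> 1"
        "\<And>j. j < N \<Longrightarrow> \<bar>a j - a' j\<bar> \<le> e" for a a' i e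
    proof -
      have "\<bar>m (step N a) (node i) - m (step N a') (node i)\<bar> \<le> \<bar>c\<bar> * (\<delta> * e)"
        by (intro m_lipschitz profile_step N that step_lipschitz)
      moreover have "\<bar>H a i - H a' i\<bar> = \<bar>m (step N a) (node i) - m (step N a') (node i)\<bar> / \<delta>"
        using \<delta>_pos by (simp add: H_def diff_divide_distrib[symmetric])
      ultimately show ?thesis using \<delta>_pos by (simp add: divide_le_eq mult.assoc mult.commute[of e])
    qed
  qed (use N in auto)
  define g where "g = step N a"
  have g: "profile g" unfolding g_def by (rule profile_step[OF N a])
  have close: "\<bar>m g (node i) - (x - \<delta> + \<delta> * a i)\<bar> \<le> \<delta> / real N" if "i < N" for i
  proof -
    have "m g (node i) - (x - \<delta> + \<delta> * a i) = \<delta> * (H a i - a i)"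
    proof -
      have "\<delta> * H a i = m g (node i) - (x - \<delta>)" using \<delta>_pos by (simp add: H_def g_def)
      then show ?thesis by (simp add: algebra_simps)
    qed
    moreover have "\<delta> * \<bar>H a i - a i\<bar> \<le> \<delta> * (1 / real N)"
      using fix_a[OF that] \<delta>_pos by (intro mult_left_mono) auto
    ultimately show ?thesis using \<delta>_pos by (simp add: abs_mult)
  qed
  show ?thesis
  proof
    show "profile g" by fact
    fix s assume s: "s \<in> {0..<T}"
    define i where "i = cell N s"
    have iN: "i < N" unfolding i_def by (rule cell_less[OF N])
    have "s * real N / T < real N" using s T_pos N by (simp add: field_simps)
    then have "\<lfloor>s * real N / T\<rfloor> \<le> int N - 1" by linarith
    moreover have nn: "0 \<le> s * real N / T" using s T_pos by simp
    ultimately have "int i = \<lfloor>s * real N / T\<rfloor>" by (auto simp: i_def cell_def)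
    then have ri: "real i \<le> s * real N / T" "s * real N / T < real i + 1" by linarith+
    then have "node i \<le> s" "s < (real i + 1) * T / real N"
      using T_pos N by (auto simp: node_def field_simps)
    then have n1: "node i \<le> s" "s - T / real N < node i"
      by (auto simp: node_def distrib_right add_divide_distrib)
    have "Min (a ` {..i}) \<in> a ` {..i}" by (rule Min_in) auto
    \<comment> \<open>The running minimum costs no accuracy. From above, a j <= a i, and a i is near
      the rescaled image at node i; from below, a j is near the image at the earlier node j, which
      is at least that at node i because \<open>m g\<close> is non-increasing.\<close>
    then obtain j where j: "j \<le> i" "Min (a ` {..i}) = a j" by blast
    have gs: "g s = x - \<delta> + \<delta> * a j" by (simp add: g_def step_def j(2) flip: i_def)
    have "a j \<le> a i" unfolding j(2)[symmetric] by (rule Min_le) auto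
    then have "\<delta> * a j \<le> \<delta> * a i" using \<delta>_pos by simp
    moreover have "m g (node i) \<le> m g (node j)"
      using j(1) T_pos by (intro antimonoD[OF m_antimono[OF g]]) (simp add: node_def divide_right_mono)
    ultimately have "\<bar>g s - m g (node i)\<bar> \<le> \<delta> / real N"
      using close[OF iN] close[of j] j(1) iN unfolding gs by (simp add: abs_le_iff)
    then show "\<exists>s'. 0 \<le> s' \<and> s' \<le> s \<and> s - T / real N < s' \<and> \<bar>g s - m g s'\<bar> \<le> \<delta> / real N"
      using n1 T_pos by (intro exI[of _ "node i"]) (auto simp: node_def)
  qed
qed

section \<open>Compactness and the limit equation\<close>

lemma profile_compact:
  assumes g: "\<And>n. profile (gs n)"
  obtains r g where "strict_mono (r :: nat \<Rightarrow> nat)" "profile g" "weak_lim (\<lambda>n. gs (r n)) g"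
proof -
  \<comment> \<open>Helly's theorem takes non-decreasing functions with a symmetric bound, hence the
    sign and the centring at x - \<delta>/2.\<close>
  let ?f = "\<lambda>n s. (x - \<delta> / 2) - gs n s"
  have bnd: "x - \<delta> \<le> gs n s" "gs n s \<le> x" for n s using g[of n] by (auto simp: profile_def)
  have "\<exists>r. strict_mono (r::nat \<Rightarrow> nat) \<and> (\<exists>F. (\<forall>s. continuous (at_right s) F) \<and> mono F \<and> (\<forall>s. \<bar>F s\<bar> \<le> \<delta> / 2) \<and>
    (\<forall>s. continuous (at s) F \<longrightarrow> (\<lambda>n. ?f (r n) s) \<longlonglongrightarrow> F s))"
  proof (rule Helly_selection)
    show "continuous (at_right s) (?f n)" for n s
      using g[of n] by (intro continuous_intros) (auto simp: profile_def)
    show "mono (?f n)" for n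
      using antimonoD[OF profile_antimono[OF g[of n]]] by (intro monoI) simp
    show "\<bar>?f n s\<bar> \<le> \<delta> / 2" for n s
      using bnd[of n s] unfolding abs_le_iff by (simp add: field_simps)
  qed
  then obtain r F where r: "strict_mono (r :: nat \<Rightarrow> nat)" and F: "\<And>s. continuous (at_right s) F" "mono F"
    "\<And>s. \<bar>F s\<bar> \<le> \<delta> / 2" "\<And>s. isCont F s \<Longrightarrow> (\<lambda>n. ?f (r n) s) \<longlonglongrightarrow> F s"
    by blast
  define G where "G s = (x - \<delta> / 2) - F s" for s
  have "profile G"
    unfolding profile_def
  proof (intro conjI allI)
    show "antimono G" using F(2) by (auto simp: G_def mono_def antimono_def)
    fix s
    show "continuous (at_right s) G" unfolding G_def by (intro continuous_intros F)
    show "x - \<delta> \<le> G s" "G s \<le> x" using F(3)[of s] unfolding G_def abs_le_iff by (simp_all add: field_simps)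
  qed
  moreover have "weak_lim (\<lambda>n. gs (r n)) G"
    unfolding weak_lim_def
  proof (intro allI impI)
    fix s assume "isCont G s"
    then have "isCont (\<lambda>s. (x - \<delta> / 2) - G s) s" by (intro continuous_intros)
    then have "isCont F s" by (simp add: G_def)
    from F(4)[OF this] have "(\<lambda>n. (x - \<delta> / 2) - ?f (r n) s) \<longlonglongrightarrow> (x - \<delta> / 2) - F s"
      by (intro tendsto_intros)
    then show "(\<lambda>n. gs (r n) s) \<longlonglongrightarrow> G s" by (simp add: G_def)
  qed
  ultimately show ?thesis using that r by blast
qed

text \<open>As \<open>s'\<close> <= s and images are non-increasing, the limit gives
  \<open>m g\<close> s <= g s at continuity points. The opposite bound survives only with the image
  taken at a strictly earlier continuity point. Both are then moved to an arbitrary s through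
  continuity points decreasing to s.\<close>

lemma exists_fixed_point:
  obtains g where "profile g" "\<And>s. s \<in> {0..<T} \<Longrightarrow> g s = m g s"
proof -
  have "\<exists>g. profile g \<and> (\<forall>s\<in>{0..<T}. \<exists>s'. 0 \<le> s' \<and> s' \<le> s \<and> s - T / real (Suc n) < s' \<and> \<bar>g s - m g s'\<bar> \<le> \<delta> / real (Suc n))" for n
    by (rule approximate_fixed_point[of "Suc n"]) auto
  then have "\<exists>h. \<forall>n. profile (h n) \<and> (\<forall>s\<in>{0..<T}. \<exists>s'. 0 \<le> s' \<and> s' \<le> s \<and> s - T / real (Suc n) < s' \<and> \<bar>h n s - m (h n) s'\<bar> \<le> \<delta> / real (Suc n))"
    by (intro choice allI)
  then obtain h where h: "\<And>n. profile (h n)"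
    "\<And>n s. s \<in> {0..<T} \<Longrightarrow> \<exists>s'. 0 \<le> s' \<and> s' \<le> s \<and> s - T / real (Suc n) < s' \<and> \<bar>h n s - m (h n) s'\<bar> \<le> \<delta> / real (Suc n)"
    by blast
  obtain r g where r: "strict_mono (r :: nat \<Rightarrow> nat)" and g: "profile g" and lim: "weak_lim (\<lambda>n. h (r n)) g"
    by (rule profile_compact[of h]) (rule h(1), blast)
  note hr = h(1)[of "r _"]
  have inv: "(\<lambda>n. k / real (Suc (r n))) \<longlonglongrightarrow> 0" for k
    using LIMSEQ_subseq_LIMSEQ[OF LIMSEQ_Suc[OF lim_const_over_n[of k]] r] by (simp add: comp_def)
  have lower: "m g s \<le> g s" if s: "s \<in> {0..<T}" "isCont g s" for s
  proof (rule LIMSEQ_le)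
    show "(\<lambda>n. m (h (r n)) s - \<delta> / real (Suc (r n))) \<longlonglongrightarrow> m g s"
      using tendsto_diff[OF m_tendsto[OF g hr lim, of s] inv[of \<delta>]] s by simp
    show "(\<lambda>n. h (r n) s) \<longlonglongrightarrow> g s" using lim s(2) by (simp add: weak_lim_def)
    have "m (h (r n)) s - \<delta> / real (Suc (r n)) \<le> h (r n) s" for n
    proof -
      obtain s' where s': "s' \<le> s" "\<bar>h (r n) s - m (h (r n)) s'\<bar> \<le> \<delta> / real (Suc (r n))"
        using h(2)[OF s(1), of "r n"] by blast
      have "m (h (r n)) s \<le> m (h (r n)) s'" by (rule antimonoD[OF m_antimono[OF hr] s'(1)])
      then show ?thesis using s'(2) by linarith
    qed
    then show "\<exists>N. \<forall>n\<ge>N. m (h (r n)) s - \<delta> / real (Suc (r n)) \<le> h (r n) s" by blast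
  qed
  have upper: "g s \<le> m g u" if s: "s \<in> {0..<T}" "isCont g s" and u: "0 \<le> u" "u < s" "isCont g u" for s u
  proof (rule LIMSEQ_le)
    show "(\<lambda>n. h (r n) s) \<longlonglongrightarrow> g s" using lim s(2) by (simp add: weak_lim_def)
    show "(\<lambda>n. m (h (r n)) u + \<delta> / real (Suc (r n))) \<longlonglongrightarrow> m g u"
      using tendsto_add[OF m_tendsto[OF g hr lim, of u] inv[of \<delta>]] s u by simp
    \<comment> \<open>Once the lag is shorter than s - u, the node \<open>s'\<close> lies to the
      right of u.\<close>
    have "\<forall>\<^sub>F n in sequentially. T / real (Suc (r n)) < s - u"
      using u by (intro order_tendstoD(2)[OF inv]) simp
    then have "\<forall>\<^sub>F n in sequentially. h (r n) s \<le> m (h (r n)) u + \<delta> / real (Suc (r n))"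
    proof eventually_elim
      case (elim n)
      obtain s' where s': "s - T / real (Suc (r n)) < s'" "\<bar>h (r n) s - m (h (r n)) s'\<bar> \<le> \<delta> / real (Suc (r n))"
        using h(2)[OF s(1), of "r n"] by blast
      have "m (h (r n)) s' \<le> m (h (r n)) u"
        using s'(1) elim by (intro antimonoD[OF m_antimono[OF hr]]) linarith
      then show ?case using s'(2) by linarith
    qed
    then show "\<exists>N. \<forall>n\<ge>N. h (r n) s \<le> m (h (r n)) u + \<delta> / real (Suc (r n))"
      by (simp add: eventually_sequentially)
  qed
  have "g s = m g s" if s: "s \<in> {0..<T}" for s
  proof (rule antisym)
    \<comment> \<open>The denominator starts at 2 so that already the first term lies below T;
      continuity points u n are then picked between s and w n.\<close>
    define w where "w n = s + (T - s) / real (Suc (Suc n))" for n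
    have w: "s < w n" "w n < T" for n
    proof -
      have "(T - s) / real (Suc (Suc n)) < T - s"
        using s mult_strict_left_mono[of 1 "real (Suc (Suc n))" "T - s"]
        by (simp add: divide_less_eq del: of_nat_Suc)
      then show "w n < T" by (simp add: w_def)
      show "s < w n" using s by (simp add: w_def)
    qed
    have "(\<lambda>n. (T - s) / real (Suc (Suc n))) \<longlonglongrightarrow> 0"
      by (rule LIMSEQ_Suc[OF LIMSEQ_Suc[OF lim_const_over_n]])
    then have w_lim: "w \<longlonglongrightarrow> s"
      using tendsto_add[OF tendsto_const[of s]] by (fastforce simp: w_def[abs_def])
    have "\<exists>u. s < u \<and> u < w n \<and> isCont g u" for n
      using antimono_isCont_between[OF profile_antimono[OF g] w(1)[of n]] by blast
    then obtain u where u: "\<And>n. s < u n" "\<And>n. u n < w n" "\<And>n. isCont g (u n)" by metis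
    have uT: "u n \<in> {0..<T}" for n using u(1,2)[of n] w(2)[of n] s by auto
    have u_lim: "u \<longlonglongrightarrow> s"
      by (rule tendsto_sandwich[OF _ _ tendsto_const w_lim]) (simp_all add: u less_imp_le)
    have "(g \<longlongrightarrow> g s) (at_right s)" using g by (simp add: profile_def continuous_within)
    then have gu: "(\<lambda>n. g (u n)) \<longlonglongrightarrow> g s"
    proof (rule filterlim_compose)
      show "filterlim u (at_right s) sequentially"
        unfolding filterlim_at using u(1) u_lim by (auto simp: less_imp_neq[symmetric])
    qed
    have mu: "(\<lambda>n. m g (u n)) \<longlonglongrightarrow> m g s"
      using s u(1) uT by (intro m_right[OF g _ _ u_lim]) (auto intro: less_imp_le)
    show "m g s \<le> g s"
      by (rule LIMSEQ_le[OF mu gu]) (use lower uT u in auto)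
    have "g (u n) \<le> m g s" for n
    proof -
      \<comment> \<open>\<open>upper\<close> compares two continuity points, so q is inserted
        between s and u n; monotonicity of the image carries the bound from q back to s.\<close>
      obtain q where q: "s < q" "q < u n" "isCont g q"
        using antimono_isCont_between[OF profile_antimono[OF g] u(1)[of n]] by blast
      have "g (u n) \<le> m g q" using q s by (intro upper uT u) auto
      also have "\<dots> \<le> m g s" using q by (intro antimonoD[OF m_antimono[OF g]]) auto
      finally show ?thesis .
    qed
    then show "g s \<le> m g s" by (intro LIMSEQ_le_const2[OF gu]) auto
  qed
  with g that show ?thesis by blast
qed

lemma Psi_restrict:
  assumes g: "profile g" and eq: "\<And>s. s \<in> {0..T} \<Longrightarrow> \<theta> s = g s"
  shows "Psi M F W T \<sigma> \<rho> K \<alpha> x \<theta> = restrict (m g) {0..T}"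
proof
  fix t
  show "Psi M F W T \<sigma> \<rho> K \<alpha> x \<theta> t = restrict (m g) {0..T} t"
    using Psi_eq(3)[OF g eq, of t] by (cases "t \<in> {0..T}") (auto simp: Psi_def)
qed

lemma Psi_maps_E_set: "\<theta> \<in> E_set T x \<delta> \<Longrightarrow> Psi M F W T \<sigma> \<rho> K \<alpha> x \<theta> \<in> E_set T x \<delta>"
  by (metis E_set_profile Psi_restrict profile_m profile_E_set)

lemma Psi_fixed_point: "\<exists>\<theta>\<in>E_set T x \<delta>. Psi M F W T \<sigma> \<rho> K \<alpha> x \<theta> = \<theta>"
proof -
  obtain g where g: "profile g" and fix_g: "\<And>s. s \<in> {0..<T} \<Longrightarrow> g s = m g s"
    using exists_fixed_point by blast
  \<comment> \<open>Nothing is known about g at T. Its image agrees with g on [0,T), hence has the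
    same control and is itself the fixed point.\<close>
  have pm: "profile (m g)" by (rule profile_m[OF g])
  have "\<xi> (m g) t \<omega> = \<xi> g t \<omega>" if "t \<le> T" for t \<omega>
    by (rule \<xi>_cong_less[OF pm g _ that]) (simp add: fix_g)
  then have "m (m g) = m g" using T_pos by (simp add: fun_eq_iff m_def[of "m g"] m_def[of g] X_def[abs_def])
  then have "Psi M F W T \<sigma> \<rho> K \<alpha> x (restrict (m g) {0..T}) = restrict (m g) {0..T}"
    using Psi_restrict[OF pm, of "restrict (m g) {0..T}"] by simp
  then show ?thesis using profile_E_set[OF pm] by blast
qed

end

theorem theorem4p8:
  fixes M :: "'a measure" and F :: "real \<Rightarrow> 'a measure" and W :: "real \<Rightarrow> 'a \<Rightarrow> real"
    and T \<sigma> \<rho> K \<alpha> x \<delta> :: real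
  assumes "0 < T" and "0 < \<sigma>" and "0 < \<rho>" and "0 < K"
    and "usual_conditions M F T"
    and "brownian_motion M F T W"
    and "sufficiently_large M F W T \<sigma> \<rho> K \<alpha> x \<delta>"
  shows "(\<forall>\<theta>\<in>E_set T x \<delta>. \<forall>t\<in>{0..T}.
            (AE \<omega> in M. opt_control M F W T \<sigma> \<rho> K \<alpha> x \<theta> t \<omega> < \<infinity>) \<and>
            integrable M (opt_state M F W T \<sigma> \<rho> K \<alpha> x \<theta> t))
       \<and> Psi M F W T \<sigma> \<rho> K \<alpha> x \<in> E_set T x \<delta> \<rightarrow> E_set T x \<delta>
       \<and> (\<exists>\<theta>\<in>E_set T x \<delta>. Psi M F W T \<sigma> \<rho> K \<alpha> x \<theta> = \<theta>)"
proof -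
  have "prob_space M" "complete_measure M" "0 < \<delta>"
    using assms by (auto simp: usual_conditions_def sufficiently_large_def)
  then interpret fixed_point_problem M F W T \<sigma> \<rho> K \<alpha> x \<delta>
    using assms by (simp add: fixed_point_problem_def fixed_point_problem_axioms_def
        control_problem_def control_problem_axioms_def)
  have "(AE \<omega> in M. opt_control M F W T \<sigma> \<rho> K \<alpha> x \<theta> t \<omega> < \<infinity>) \<and>
      integrable M (opt_state M F W T \<sigma> \<rho> K \<alpha> x \<theta> t)"
    if "\<theta> \<in> E_set T x \<delta>" "t \<in> {0..T}" for \<theta> t
    using E_set_profile[OF that(1)] Psi_eq(1,2)[OF _ _ that(2)] by metis
  then show ?thesis using Psi_maps_E_set Psi_fixed_point by blast
qed

end
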